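(* Let $G=\langle L,l_0,\Sigma,\Delta,\mathcal{O},\gamma\rangle$ be a game structure of imperfect information and $H=\mathsf{Knw}(G)$ with initial state $q_0$. For all Borel objectives $\phi$ for $G$, all observation-based (randomized) Player-1 strategies $\alpha_G$ in $G$, and all (randomized) Player-2 strategies $\beta_G$ in $G$, we have $\Pr_{l_0}^{\alpha_G,\beta_G}(\phi)=\Pr_{q_0}^{\bar h(\alpha_G),\bar h(\beta_G)}(h(\phi))$. Dually, for all equivalence-preserving Borel objectives $\phi$ for $H$, all equivalence-preserving Player-1 strategies $\alpha_H$ in $H$, and all Player-2 strategies $\beta_H$ in $H$, we have $\Pr_{q_0}^{\alpha_H,\beta_H}(\phi)=\Pr_{l_0}^{\bar g(\alpha_H),\bar g(\beta_H)}(h^{-1}(\phi))$.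
   Context: Game structure $G$: $L$ finite states, $l_0$ initial, $\Sigma$ finite alphabet, $\Delta\subseteq L\times\Sigma\times L$ total, $\mathcal{O}$ finite observations, $\gamma:\mathcal{O}\to2^L\setminus\{\emptyset\}$ partitioning $L$; $\mathsf{Post}_\sigma(s)=\{\ell'\mid\exists\ell\in s:(\ell,\sigma,\ell')\in\Delta\}$. Plays are $\ell_0\sigma_0\ell_1\dots$ from $l_0$ following $\Delta$; $\mathrm{Prefs}(G)$ denotes the finite prefixes ending in a state, $\rho(i)$ the prefix of $\rho$ up to its $i$-th state. Observation sequence: $o_0\sigma_0o_1\dots$ with $\ell_i\in\gamma(o_i)$. Knowledge $K(\tau)=\{\mathsf{Last}(\rho)\mid\rho\in\mathrm{Prefs}(G),\ \rho\text{ has observation sequence }\tau\}$. A randomized Player-1 strategy is $\alpha:\mathrm{Prefs}(G)\to\mathcal{D}(\Sigma)$ (probability distributions); observation-based if equal on prefixes with equal observation sequences. A randomized Player-2 strategy is $\beta:\mathrm{Prefs}(G)\times\Sigma\to\mathcal{D}(L)$ supported on $\Delta$-successors of the last state. $\Pr_{\ell}^{\alpha,\beta}$ is the induced probability measure on plays (from $\ell$). An objective for $G$ is a set of plays determined by observation sequences, i.e. a subset of $(\mathcal{O}\times\Sigma)^\omega$; Borel means Borel in the Cantor topology. $H=\mathsf{Knw}(G)=\langle Q,q_0,\Sigma,\Delta_H\rangle$ is the perfect-information game with $Q=\{(s,\ell)\mid\exists o: s\subseteq\gamma(o),\ \ell\in s\}$, $q_0=(\{l_0\},l_0)$, and $((s,\ell),\sigma,(s',\ell'))\in\Delta_H$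 iff there is $o\in\mathcal{O}$ with $s'=\mathsf{Post}_\sigma(s)\cap\gamma(o)$ and $(\ell,\sigma,\ell')\in\Delta$. States $(s,\ell)\approx(s',\ell')$ iff $s=s'$; prefixes (plays) of $H$ are equivalent if they have the same letters and pairwise equivalent states. Strategies of $H$ are as for $G$ (without observation restriction); a Player-1 strategy $\alpha$ in $H$ is equivalence-preserving if $\alpha(\rho)=\alpha(\rho')$ whenever $\rho\approx\rho'$. An objective for $H$ is a set of plays of $H$; it is equivalence-preserving if it is closed under $\approx$. The map $h:\mathrm{Prefs}(G)\to\mathrm{Prefs}(H)$ sends $\ell_0\sigma_0\dots\sigma_{n-1}\ell_n$ to $(s_0,\ell_0)\sigma_0\dots\sigma_{n-1}(s_n,\ell_n)$ with $s_i=K(\text{observation sequence of }\rho(i))$; it is a bijection onto $\mathrm{Prefs}(H)$, and is extended to plays and to sets of plays. Strategy maps: $\bar g(\alpha_H)(\rho)=\alpha_H(h(\rho))$; $\bar h(\alpha_G)(\rho)=\alpha_G(h^{-1}(\rho))$; $\bar g(\beta_H)(\rho,\sigma)(\ell')=\beta_H(h(\rho),\sigma)((s',\ell'))$ if $((s,\ell),\sigma,(s',\ell'))\in\Delta_H$ for $s=K(\text{obs. seq. of }\rho)$, $\ell=\mathsf{Last}(\rho)$ and some (necessarily unique) $s'$, and $0$ otherwise; $\bar h(\beta_G)(\rho,\sigma)((s,\ell))=\beta_G(h^{-1}(\rho),\sigma)(\ell)$. *)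

theory Defs
  imports "HOL-Probability.Probability"
begin

record ('l, 'a) arena =
  states :: "'l set"
  start :: 'l
  alphabet :: "'a set"
  delta :: "('l \<times> 'a \<times> 'l) set"

record ('l, 'a, 'o) obs_arena = "('l, 'a) arena" +
  observations :: "'o set"
  gam :: "'o \<Rightarrow> 'l set"

definition arena :: "('l, 'a, 'z) arena_scheme \<Rightarrow> bool" where
  "arena G \<longleftrightarrow>
     finite (states G) \<and> start G \<in> states G \<and> finite (alphabet G) \<and>
     delta G \<subseteq> states G \<times> alphabet G \<times> states G \<and>
     (\<forall>l\<in>states G. \<forall>a\<in>alphabet G. \<exists>l'. (l, a, l') \<in> delta G)"

definition game_structure :: "('l, 'a, 'o) obs_arena \<Rightarrow> bool" where
  "game_structure G \<longleftrightarrow>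
     arena G \<and> finite (observations G) \<and>
     (\<forall>x\<in>observations G. gam G x \<noteq> {}) \<and>
     disjoint_family_on (gam G) (observations G) \<and>
     (\<Union>x\<in>observations G. gam G x) = states G"

definition Post :: "('l, 'a, 'z) arena_scheme \<Rightarrow> 'a \<Rightarrow> 'l set \<Rightarrow> 'l set" where
  "Post G a s = {l'. \<exists>l\<in>s. (l, a, l') \<in> delta G}"

text \<open>A play \<open>l\<^sub>0 a\<^sub>0 l\<^sub>1 a\<^sub>1 \<dots>\<close> is the sequence of the pairs \<open>(l\<^sub>i, a\<^sub>i)\<close>; a finite prefix
  \<open>l\<^sub>0 a\<^sub>0 \<dots> a\<^sub>n\<^sub>-\<^sub>1 l\<^sub>n\<close> is the list of its first \<open>n\<close> pairs together with its last state \<open>l\<^sub>n\<close>.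
  Observation sequences are encoded in the same way.\<close>

type_synonym ('l, 'a) play = "nat \<Rightarrow> 'l \<times> 'a"
type_synonym ('l, 'a) pref = "('l \<times> 'a) list \<times> 'l"

definition Plays :: "('l, 'a, 'z) arena_scheme \<Rightarrow> ('l, 'a) play set" where
  "Plays G = {\<pi>. fst (\<pi> 0) = start G \<and>
     (\<forall>i. fst (\<pi> i) \<in> states G \<and> snd (\<pi> i) \<in> alphabet G \<and>
          (fst (\<pi> i), snd (\<pi> i), fst (\<pi> (Suc i))) \<in> delta G)}"

definition play_pref :: "('l, 'a) play \<Rightarrow> nat \<Rightarrow> ('l, 'a) pref" where
  "play_pref \<pi> n = (map \<pi> [0..<n], fst (\<pi> n))"

definition Prefs :: "('l, 'a, 'z) arena_scheme \<Rightarrow> ('l, 'a) pref set" where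
  "Prefs G = {play_pref \<pi> n | \<pi> n. \<pi> \<in> Plays G}"

abbreviation Last :: "('l, 'a) pref \<Rightarrow> 'l" where
  "Last \<rho> \<equiv> snd \<rho>"

definition pref_state :: "('l, 'a) pref \<Rightarrow> nat \<Rightarrow> 'l" where
  "pref_state \<rho> i = (map fst (fst \<rho>) @ [Last \<rho>]) ! i"

definition pref_upto :: "('l, 'a) pref \<Rightarrow> nat \<Rightarrow> ('l, 'a) pref" where
  "pref_upto \<rho> i = (take i (fst \<rho>), pref_state \<rho> i)"

definition state_obs :: "('l, 'a, 'o) obs_arena \<Rightarrow> 'l \<Rightarrow> 'o" where
  "state_obs G l = (THE x. x \<in> observations G \<and> l \<in> gam G x)"

definition play_obs :: "('l, 'a, 'o) obs_arena \<Rightarrow> ('l, 'a) play \<Rightarrow> ('o, 'a) play" where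
  "play_obs G \<pi> = (\<lambda>i. (state_obs G (fst (\<pi> i)), snd (\<pi> i)))"

definition pref_obs :: "('l, 'a, 'o) obs_arena \<Rightarrow> ('l, 'a) pref \<Rightarrow> ('o, 'a) pref" where
  "pref_obs G \<rho> = (map (\<lambda>(l, a). (state_obs G l, a)) (fst \<rho>), state_obs G (Last \<rho>))"

definition Knowledge :: "('l, 'a, 'o) obs_arena \<Rightarrow> ('o, 'a) pref \<Rightarrow> 'l set" where
  "Knowledge G \<tau> = {Last \<rho> | \<rho>. \<rho> \<in> Prefs G \<and> pref_obs G \<rho> = \<tau>}"

type_synonym ('l, 'a) strat1 = "('l, 'a) pref \<Rightarrow> 'a pmf"
type_synonym ('l, 'a) strat2 = "('l, 'a) pref \<Rightarrow> 'a \<Rightarrow> 'l pmf"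

definition strategy1 :: "('l, 'a, 'z) arena_scheme \<Rightarrow> ('l, 'a) strat1 \<Rightarrow> bool" where
  "strategy1 G \<alpha> \<longleftrightarrow> (\<forall>\<rho>\<in>Prefs G. set_pmf (\<alpha> \<rho>) \<subseteq> alphabet G)"

definition strategy2 :: "('l, 'a, 'z) arena_scheme \<Rightarrow> ('l, 'a) strat2 \<Rightarrow> bool" where
  "strategy2 G \<beta> \<longleftrightarrow>
     (\<forall>\<rho>\<in>Prefs G. \<forall>a\<in>alphabet G. set_pmf (\<beta> \<rho> a) \<subseteq> {l'. (Last \<rho>, a, l') \<in> delta G})"

definition observation_based :: "('l, 'a, 'o) obs_arena \<Rightarrow> ('l, 'a) strat1 \<Rightarrow> bool" where
  "observation_based G \<alpha> \<longleftrightarrow>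
     (\<forall>\<rho>\<in>Prefs G. \<forall>\<rho>'\<in>Prefs G. pref_obs G \<rho> = pref_obs G \<rho>' \<longrightarrow> \<alpha> \<rho> = \<alpha> \<rho>')"

text \<open>The measure induced by two strategies from a state \<open>l\<close> is the Ionescu-Tulcea limit of the
  one-step kernels: the pair \<open>(l\<^sub>n\<^sub>+\<^sub>1, a\<^sub>n\<^sub>+\<^sub>1)\<close> is drawn, given the pairs up to \<open>n\<close>, by letting
  Player 2 choose \<open>l\<^sub>n\<^sub>+\<^sub>1\<close> and then Player 1 choose \<open>a\<^sub>n\<^sub>+\<^sub>1\<close>. It lives on all sequences over the
  ambient types and gives mass 1 to the plays when \<open>l\<close> is the initial state. The kernels are
  measurable for arbitrary \<open>\<alpha>\<close> and \<open>\<beta>\<close> because the ambient types are finite; a finite game whose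
  carriers are sets in larger types has to be transferred to finite types first.\<close>

fun play_step ::
  "('l, 'a) strat1 \<Rightarrow> ('l, 'a) strat2 \<Rightarrow> 'l \<Rightarrow> nat \<Rightarrow> ('l, 'a) play \<Rightarrow> ('l \<times> 'a) pmf" where
  "play_step \<alpha> \<beta> l 0 \<pi> = map_pmf (Pair l) (\<alpha> ([], l))"
| "play_step \<alpha> \<beta> l (Suc n) \<pi> =
     bind_pmf (\<beta> (play_pref \<pi> n) (snd (\<pi> n)))
       (\<lambda>l'. map_pmf (Pair l') (\<alpha> (map \<pi> [0..<Suc n], l')))"

definition play_kernel ::
  "('l, 'a) strat1 \<Rightarrow> ('l, 'a) strat2 \<Rightarrow> 'l \<Rightarrow> nat \<Rightarrow> ('l, 'a) play \<Rightarrow> ('l \<times> 'a) measure" where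
  "play_kernel \<alpha> \<beta> l n \<pi> = measure_pmf (play_step \<alpha> \<beta> l n \<pi>)"

definition play_measure ::
  "('l, 'a) strat1 \<Rightarrow> ('l, 'a) strat2 \<Rightarrow> 'l \<Rightarrow> ('l, 'a) play measure" where
  "play_measure \<alpha> \<beta> l =
     projective_family.lim UNIV
       (Ionescu_Tulcea.CI (play_kernel \<alpha> \<beta> l) (\<lambda>_. count_space UNIV)) (\<lambda>_. count_space UNIV)"

lemma Ionescu_Tulcea_play_kernel:
  fixes \<alpha> :: "('l::finite, 'a::finite) strat1"
  shows "Ionescu_Tulcea (play_kernel \<alpha> \<beta> l) (\<lambda>_. count_space UNIV)"
proof (rule Ionescu_Tulcea.intro)
  fix n :: nat
  have "PiM {0..<n} (\<lambda>_. count_space (UNIV :: ('l \<times> 'a) set)) = count_space ({0..<n} \<rightarrow>\<^sub>E UNIV)"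
    by (rule count_space_PiM_finite) auto
  then show "play_kernel \<alpha> \<beta> l n \<in>
      PiM {0..<n} (\<lambda>_. count_space UNIV) \<rightarrow>\<^sub>M subprob_algebra (count_space UNIV)"
    by (simp add: play_kernel_def measure_pmf_in_subprob_algebra)
qed (simp add: play_kernel_def prob_space_measure_pmf)

lemma prob_space_play_measure:
  fixes \<alpha> :: "('l::finite, 'a::finite) strat1"
  shows "prob_space (play_measure \<alpha> \<beta> l)"
proof -
  interpret Ionescu_Tulcea "play_kernel \<alpha> \<beta> l" "\<lambda>_. count_space UNIV"
    by (rule Ionescu_Tulcea_play_kernel)
  show ?thesis
    unfolding play_measure_def
    by (rule prob_space_distrD[of "\<lambda>x. restrict x {}" _ "PiM {} (\<lambda>_. count_space UNIV)"])
       (auto simp: distr_lim PF.prob_space_P measurable_cong_sets[OF PF.sets_lim refl]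
             intro!: measurable_restrict)
qed

lemma sets_play_measure:
  fixes \<alpha> :: "('l::finite, 'a::finite) strat1"
  shows "sets (play_measure \<alpha> \<beta> l) = sets (PiM UNIV (\<lambda>_. count_space UNIV))"
proof -
  interpret Ionescu_Tulcea "play_kernel \<alpha> \<beta> l" "\<lambda>_. count_space UNIV"
    by (rule Ionescu_Tulcea_play_kernel)
  show ?thesis by (simp add: play_measure_def)
qed

lemma play_step_cong:
  "(\<And>i. i < n \<Longrightarrow> \<pi> i = \<pi>' i) \<Longrightarrow> play_step \<alpha> \<beta> l n \<pi> = play_step \<alpha> \<beta> l n \<pi>'"
proof (cases n)
  case (Suc m)
  assume eq: "\<And>i. i < n \<Longrightarrow> \<pi> i = \<pi>' i"
  have "map \<pi> [0..<m] = map \<pi>' [0..<m]" "\<pi> m = \<pi>' m"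
    using eq Suc by auto
  then show ?thesis by (simp add: Suc play_pref_def del: map_eq_conv)
qed simp

lemma emeasure_play_measure_cylinder:
  fixes \<alpha> :: "('l::finite, 'a::finite) strat1"
  shows "emeasure (play_measure \<alpha> \<beta> l) {\<pi>. \<forall>i<n. \<pi> i = x i} =
    (\<Prod>i<n. ennreal (pmf (play_step \<alpha> \<beta> l i x) (x i)))"
proof -
  interpret Ionescu_Tulcea "play_kernel \<alpha> \<beta> l" "\<lambda>_. count_space UNIV"
    by (rule Ionescu_Tulcea_play_kernel)
  let ?M = "\<lambda>n::nat. PiM {0..<n} (\<lambda>_. count_space (UNIV :: ('l \<times> 'a) set))"
  have M: "?M n = count_space ({0..<n} \<rightarrow>\<^sub>E UNIV)" for n :: nat
    by (rule count_space_PiM_finite) auto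
  have u: "(\<lambda>_. undefined) \<in> space (?M 0)" by (simp add: space_PiM)
  have x: "{restrict x {0..<n}} \<in> sets (?M n)" for n
    by (auto simp: M)
  have C: "emeasure (C 0 n (\<lambda>_. undefined)) {restrict x {0..<n}} =
    (\<Prod>i<n. ennreal (pmf (play_step \<alpha> \<beta> l i x) (x i)))" for n
  proof (induction n)
    case 0
    then show ?case using x[of 0] by (simp add: restrict_def)
  next
    case (Suc n)
    have eP: "emeasure (eP n \<omega>) {restrict x {0..<Suc n}} =
        ennreal (pmf (play_step \<alpha> \<beta> l n x) (x n)) * indicator {restrict x {0..<n}} \<omega>"
      if w: "\<omega> \<in> space (?M n)" for \<omega>
    proof -
      have ext: "\<omega> \<in> extensional {0..<n}" using w by (auto simp: space_PiM PiE_iff)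
      have iff: "fun_upd \<omega> n y = restrict x {0..<Suc n} \<longleftrightarrow> y = x n \<and> \<omega> = restrict x {0..<n}" for y
      proof safe
        assume eq: "fun_upd \<omega> n y = restrict x {0..<Suc n}"
        show "y = x n" using fun_cong[OF eq, of n] by simp
        show "\<omega> = restrict x {0..<n}"
        proof
          fix i show "\<omega> i = restrict x {0..<n} i"
            using fun_cong[OF eq, of i] ext
            by (cases "i < n") (auto simp: extensional_def split: if_splits)
        qed
      qed (auto simp: fun_eq_iff)
      have "(fun_upd \<omega> n -` {restrict x {0..<Suc n}} \<inter> space (count_space UNIV)) =
        (if \<omega> = restrict x {0..<n} then {x n} else {})"
        using iff by auto
      moreover have "play_step \<alpha> \<beta> l n (restrict x {0..<n}) = play_step \<alpha> \<beta> l n x"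
        by (rule play_step_cong) simp
      ultimately show ?thesis
        by (simp add: emeasure_eP[OF w x] play_kernel_def emeasure_pmf_single)
    qed
    have "emeasure (C 0 (Suc n) (\<lambda>_. undefined)) {restrict x {0..<Suc n}} =
      (\<integral>\<^sup>+\<omega>. emeasure (eP n \<omega>) {restrict x {0..<Suc n}} \<partial>C 0 n (\<lambda>_. undefined))"
      unfolding C.simps add_0
    proof (rule emeasure_bind[where N="?M (Suc n)"])
      show "space (C 0 n (\<lambda>_. undefined)) \<noteq> {}"
        using space_C[OF u, of n] by (simp add: space_PiM PiE_eq_empty_iff)
      show "eP n \<in> C 0 n (\<lambda>_. undefined) \<rightarrow>\<^sub>M subprob_algebra (?M (Suc n))"
        using measurable_eP[of n] sets_C[OF u, of n]
        by (simp add: measurable_cong_sets[where M="C 0 n (\<lambda>_. undefined)" and M'="?M n"])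
    qed (rule x)
    also have "\<dots> = (\<integral>\<^sup>+\<omega>. ennreal (pmf (play_step \<alpha> \<beta> l n x) (x n)) *
        indicator {restrict x {0..<n}} \<omega> \<partial>C 0 n (\<lambda>_. undefined))"
      using space_C[OF u, of n] by (intro nn_integral_cong) (simp add: eP)
    also have "\<dots> = ennreal (pmf (play_step \<alpha> \<beta> l n x) (x n)) *
        emeasure (C 0 n (\<lambda>_. undefined)) {restrict x {0..<n}}"
      using x[of n] sets_C[OF u, of n] by (subst nn_integral_cmult_indicator) auto
    finally show ?case
      unfolding Suc by (simp only: prod.lessThan_Suc mult.commute)
  qed
  have "{\<pi>. \<forall>i<n. \<pi> i = x i} =
      prod_emb UNIV (\<lambda>_. count_space UNIV) {0..<n} {restrict x {0..<n}}"
    by (auto simp: prod_emb_def fun_eq_iff restrict_def) metis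
  then have "emeasure (play_measure \<alpha> \<beta> l) {\<pi>. \<forall>i<n. \<pi> i = x i} =
      emeasure (CI {0..<n}) {restrict x {0..<n}}"
    unfolding play_measure_def using lim[OF _ x, of n] by simp
  also have "\<dots> = emeasure (C 0 n (\<lambda>_. undefined)) {restrict x {0..<n}}"
    using emeasure_CI[OF subset_refl x[of n]] x[of n] by (simp add: prod_emb_id M)
  finally show ?thesis by (simp add: C)
qed

definition Knw :: "('l, 'a, 'o) obs_arena \<Rightarrow> ('l set \<times> 'l, 'a) arena" where
  "Knw G =
     (let Q = {(s, l). (\<exists>x\<in>observations G. s \<subseteq> gam G x) \<and> l \<in> s} in
      \<lparr>states = Q, start = ({start G}, start G), alphabet = alphabet G,
       delta = {((s, l), a, (s', l')). (s, l) \<in> Q \<and> a \<in> alphabet G \<and> (s', l') \<in> Q \<and>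
         (\<exists>x\<in>observations G. s' = Post G a s \<inter> gam G x) \<and> (l, a, l') \<in> delta G}\<rparr>)"

definition state_equiv :: "'l set \<times> 'l \<Rightarrow> 'l set \<times> 'l \<Rightarrow> bool" where
  "state_equiv q q' \<longleftrightarrow> fst q = fst q'"

definition pref_equiv :: "('l set \<times> 'l, 'a) pref \<Rightarrow> ('l set \<times> 'l, 'a) pref \<Rightarrow> bool" where
  "pref_equiv \<rho> \<rho>' \<longleftrightarrow>
     list_all2 (\<lambda>(q, a) (q', a'). state_equiv q q' \<and> a = a') (fst \<rho>) (fst \<rho>') \<and>
     state_equiv (Last \<rho>) (Last \<rho>')"

definition play_equiv :: "('l set \<times> 'l, 'a) play \<Rightarrow> ('l set \<times> 'l, 'a) play \<Rightarrow> bool" where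
  "play_equiv \<pi> \<pi>' \<longleftrightarrow>
     (\<forall>i. state_equiv (fst (\<pi> i)) (fst (\<pi>' i)) \<and> snd (\<pi> i) = snd (\<pi>' i))"

definition equiv_preserving_strategy ::
  "('l set \<times> 'l, 'a) arena \<Rightarrow> ('l set \<times> 'l, 'a) strat1 \<Rightarrow> bool" where
  "equiv_preserving_strategy H \<alpha> \<longleftrightarrow>
     (\<forall>\<rho>\<in>Prefs H. \<forall>\<rho>'\<in>Prefs H. pref_equiv \<rho> \<rho>' \<longrightarrow> \<alpha> \<rho> = \<alpha> \<rho>')"

definition equiv_preserving_objective ::
  "('l set \<times> 'l, 'a) arena \<Rightarrow> ('l set \<times> 'l, 'a) play set \<Rightarrow> bool" where
  "equiv_preserving_objective H \<phi> \<longleftrightarrow>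
     (\<forall>\<pi>\<in>\<phi>. \<forall>\<pi>'\<in>Plays H. play_equiv \<pi> \<pi>' \<longrightarrow> \<pi>' \<in> \<phi>)"

definition cantor_topology :: "'b set \<Rightarrow> (nat \<Rightarrow> 'b) topology" where
  "cantor_topology A = product_topology (\<lambda>_. discrete_topology A) UNIV"

definition borel_sets :: "'b topology \<Rightarrow> 'b set set" where
  "borel_sets X = sigma_sets (topspace X) {U. openin X U}"

definition borel_obs_objective :: "('l, 'a, 'o) obs_arena \<Rightarrow> ('l, 'a) play set \<Rightarrow> bool" where
  "borel_obs_objective G \<phi> \<longleftrightarrow>
     (\<exists>B \<in> borel_sets (cantor_topology (observations G \<times> alphabet G)).
        \<phi> = {\<pi>\<in>Plays G. play_obs G \<pi> \<in> B})"

text \<open>The plays form a closed set of sequences, so Borel sets of plays are the Borel sets of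
  sequences that consist of plays.\<close>

definition borel_objective :: "('l, 'a, 'z) arena_scheme \<Rightarrow> ('l, 'a) play set \<Rightarrow> bool" where
  "borel_objective H \<phi> \<longleftrightarrow>
     \<phi> \<subseteq> Plays H \<and> \<phi> \<in> borel_sets (cantor_topology (states H \<times> alphabet H))"

definition h_pref :: "('l, 'a, 'o) obs_arena \<Rightarrow> ('l, 'a) pref \<Rightarrow> ('l set \<times> 'l, 'a) pref" where
  "h_pref G \<rho> =
     (let s = (\<lambda>i. Knowledge G (pref_obs G (pref_upto \<rho> i))); n = length (fst \<rho>) in
      (map (\<lambda>i. ((s i, pref_state \<rho> i), snd (fst \<rho> ! i))) [0..<n], (s n, pref_state \<rho> n)))"

definition h_play :: "('l, 'a, 'o) obs_arena \<Rightarrow> ('l, 'a) play \<Rightarrow> ('l set \<times> 'l, 'a) play" where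
  "h_play G \<pi> =
     (\<lambda>i. ((Knowledge G (pref_obs G (play_pref \<pi> i)), fst (\<pi> i)), snd (\<pi> i)))"

abbreviation h_pref_inv :: "('l, 'a, 'o) obs_arena \<Rightarrow> ('l set \<times> 'l, 'a) pref \<Rightarrow> ('l, 'a) pref" where
  "h_pref_inv G \<equiv> inv_into (Prefs G) (h_pref G)"

definition g_bar1 ::
  "('l, 'a, 'o) obs_arena \<Rightarrow> ('l set \<times> 'l, 'a) strat1 \<Rightarrow> ('l, 'a) strat1" where
  "g_bar1 G \<alpha> = (\<lambda>\<rho>. \<alpha> (h_pref G \<rho>))"

definition h_bar1 ::
  "('l, 'a, 'o) obs_arena \<Rightarrow> ('l, 'a) strat1 \<Rightarrow> ('l set \<times> 'l, 'a) strat1" where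
  "h_bar1 G \<alpha> = (\<lambda>\<rho>. \<alpha> (h_pref_inv G \<rho>))"

definition g_bar2 ::
  "('l, 'a, 'o) obs_arena \<Rightarrow> ('l set \<times> 'l, 'a) strat2 \<Rightarrow> ('l, 'a) strat2" where
  "g_bar2 G \<beta> = (\<lambda>\<rho> a. embed_pmf (\<lambda>l'.
     let q = (Knowledge G (pref_obs G \<rho>), Last \<rho>) in
     if \<exists>s'. (q, a, (s', l')) \<in> delta (Knw G)
     then pmf (\<beta> (h_pref G \<rho>) a) (THE s'. (q, a, (s', l')) \<in> delta (Knw G), l')
     else 0))"

text \<open>The weight \<open>\<beta> (h\<inverse> \<rho>) a l'\<close> goes to the unique successor of \<open>Last \<rho>\<close> in \<open>Knw G\<close> with
  second component \<open>l'\<close>; pairs that are not successors get weight 0, since otherwise the weights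
  would not add up to 1.\<close>

definition h_bar2 ::
  "('l, 'a, 'o) obs_arena \<Rightarrow> ('l, 'a) strat2 \<Rightarrow> ('l set \<times> 'l, 'a) strat2" where
  "h_bar2 G \<beta> = (\<lambda>\<rho> a. embed_pmf (\<lambda>q'.
     if (Last \<rho>, a, q') \<in> delta (Knw G) then pmf (\<beta> (h_pref_inv G \<rho>) a) (snd q') else 0))"

end

theory Submission
  imports Defs
begin

text \<open>The map h sends the plays of G bijectively onto the plays of Knw(G), its inverse is the
  projection to the state component, and two plays agree up to step n iff their images do.
  Corresponding strategies give corresponding one-step weights, so h carries the measure of a
  cylinder around a play to that of the cylinder around its image. Both measures are concentrated
  on plays and cylinders generate the sigma-algebra, so the measure on Knw(G) is the image measure
  under h.\<close>

section \<open>Cylinder sets\<close>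

text \<open>Both halves of the theorem rest on one statement about a pair of strategies on each
  side, \<open>play_measure_Knw\<close>. It asks that Player 1's choices agree along
  \<open>h_pref\<close> and that Player 2's distribution in G be the \<open>snd\<close>-image of the
  one in Knw(G); this relation is the same whether strategies are carried up or down. The crux is
  that the knowledge component of a successor is determined by the other data, so \<open>snd\<close>
  merges no two successors and no weights are added up. The obstacle is that the measures live on
  all sequences over the types, not on plays. There \<open>h_play\<close> is still injective but not
  onto, so a cylinder of the target need not come from a cylinder of the source; those that miss all
  images of plays are null on both sides. Objectives in turn are Borel in a space of sequences over
  a carrier set and must be pulled back to the sigma-algebra of all sequences; images under
  \<open>h_play\<close> become measurable as preimages under the projection.\<close>

definition cylinder :: "nat \<Rightarrow> (nat \<Rightarrow> 'b) \<Rightarrow> (nat \<Rightarrow> 'b) set" where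
  "cylinder n x = {\<pi>. \<forall>i<n. \<pi> i = x i}"

definition cylinders :: "(nat \<Rightarrow> 'b) set set" where
  "cylinders = {cylinder n x | n x. True}"

abbreviation seq_algebra :: "(nat \<Rightarrow> 'b) measure" where
  "seq_algebra \<equiv> PiM UNIV (\<lambda>_. count_space UNIV)"

lemma cylinder_self: "x \<in> cylinder n x"
  by (simp add: cylinder_def)

lemma cylinder_eqI: "y \<in> cylinder n x \<Longrightarrow> cylinder n y = cylinder n x"
  by (auto simp: cylinder_def)

text \<open>A cylinder is coded by the finite list of its prescribed values. Countability is used
  twice: open sets become measurable, and the union of all null cylinders stays null.\<close>

lemma countable_cylinders: "countable (cylinders :: (nat \<Rightarrow> 'b::countable) set set)"
proof -
  have "cylinders \<subseteq> range (\<lambda>xs. cylinder (length xs) (nth (xs :: 'b list)))"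
  proof
    fix C :: "(nat \<Rightarrow> 'b) set"
    assume "C \<in> cylinders"
    then obtain n x where "C = cylinder n x" by (auto simp: cylinders_def)
    then have "C = cylinder (length (map x [0..<n])) (nth (map x [0..<n]))"
      by (simp add: cylinder_def)
    then show "C \<in> range (\<lambda>xs. cylinder (length xs) (nth xs))" by blast
  qed
  then show ?thesis by (rule countable_subset) simp
qed

text \<open>The hypothesis says that \<open>S\<close> is open; such a set is the union of the
  countably many cylinders inside it. Most measurability proofs below reduce to this
  criterion.\<close>

lemma union_of_cylinders_in_sigma:
  fixes S :: "(nat \<Rightarrow> 'b::countable) set"
  assumes "\<And>x. x \<in> S \<Longrightarrow> \<exists>n. cylinder n x \<subseteq> S"
  shows "S \<in> sigma_sets UNIV cylinders"
proof -
  have "S = \<Union>{C \<in> cylinders. C \<subseteq> S}"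
  proof
    show "S \<subseteq> \<Union>{C \<in> cylinders. C \<subseteq> S}"
    proof
      fix x assume "x \<in> S"
      then obtain n where "cylinder n x \<subseteq> S" using assms by blast
      moreover have "cylinder n x \<in> cylinders" by (auto simp: cylinders_def)
      ultimately show "x \<in> \<Union>{C \<in> cylinders. C \<subseteq> S}" using cylinder_self by blast
    qed
  qed blast
  moreover have "countable {C \<in> cylinders. C \<subseteq> S}"
    by (rule countable_subset[OF _ countable_cylinders]) blast
  ultimately show ?thesis
    by (metis (mono_tags, lifting) sigma_sets_UNION mem_Collect_eq sigma_sets.Basic)
qed

lemma cylinder_in_sets [measurable]: "cylinder n x \<in> sets seq_algebra"
proof -
  \<comment> \<open>The factor \<open>space seq_algebra\<close> settles \<open>n = 0\<close>, since
    \<open>sets.finite_INT\<close> wants a nonempty index set.\<close>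
  have "cylinder n x = (\<Inter>i\<in>{..<n}. {\<pi> \<in> space seq_algebra. \<pi> i \<in> {x i}}) \<inter> space seq_algebra"
    by (auto simp: cylinder_def space_PiM)
  also have "\<dots> \<in> sets seq_algebra"
    by (cases n) (auto intro!: sets.Int sets.finite_INT measurable_sets_Collect)
  finally show ?thesis .
qed

text \<open>A condition on coordinate \<open>i\<close> is decided by the first \<open>Suc i\<close>
  entries, hence open.\<close>

lemma sets_seq_algebra:
  "sets (seq_algebra :: (nat \<Rightarrow> 'b::countable) measure) = sigma_sets UNIV cylinders"
proof
  have "{f. f i \<in> A} \<in> sigma_sets UNIV cylinders" for i and A :: "'b set"
  proof (rule union_of_cylinders_in_sigma)
    fix x assume "x \<in> {f. f i \<in> A}"
    then have "cylinder (Suc i) x \<subseteq> {f. f i \<in> A}" by (auto simp: cylinder_def)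
    then show "\<exists>n. cylinder n x \<subseteq> {f. f i \<in> A}" by blast
  qed
  then show "sets (seq_algebra :: (nat \<Rightarrow> 'b) measure) \<subseteq> sigma_sets UNIV cylinders"
    by (auto simp: sets_PiM_single intro!: sigma_sets_mono)
  have "cylinders \<subseteq> sets (seq_algebra :: (nat \<Rightarrow> 'b) measure)"
    unfolding cylinders_def using cylinder_in_sets by blast
  from sets.sigma_sets_subset[OF this]
  show "sigma_sets UNIV cylinders \<subseteq> sets (seq_algebra :: (nat \<Rightarrow> 'b) measure)"
    by (simp add: space_PiM)
qed

lemma union_of_cylinders_measurable:
  fixes S :: "(nat \<Rightarrow> 'b::countable) set"
  assumes "\<And>x. x \<in> S \<Longrightarrow> \<exists>n. cylinder n x \<subseteq> S"
  shows "S \<in> sets seq_algebra"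
  using union_of_cylinders_in_sigma[OF assms] by (simp add: sets_seq_algebra)

text \<open>For a causal map, whose output at \<open>i\<close> reads the input only up to
  \<open>i\<close>, the preimage of a condition on one coordinate is open. Both
  \<open>h_play\<close> and \<open>proj_play\<close> are of this kind.\<close>

lemma measurable_seqI:
  fixes f :: "(nat \<Rightarrow> 'b::countable) \<Rightarrow> nat \<Rightarrow> 'c::countable"
  assumes "\<And>\<pi> \<pi>' i. \<pi>' \<in> cylinder (Suc i) \<pi> \<Longrightarrow> f \<pi>' i = f \<pi> i"
  shows "f \<in> seq_algebra \<rightarrow>\<^sub>M seq_algebra"
proof (rule measurable_PiM_single')
  fix i
  show "(\<lambda>\<pi>. f \<pi> i) \<in> seq_algebra \<rightarrow>\<^sub>M count_space UNIV"
  proof (rule measurableI)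
    fix S :: "'c set"
    have "(\<lambda>\<pi>. f \<pi> i) -` S \<in> sets seq_algebra"
    proof (rule union_of_cylinders_measurable)
      fix \<pi> assume "\<pi> \<in> (\<lambda>\<pi>. f \<pi> i) -` S"
      then have "cylinder (Suc i) \<pi> \<subseteq> (\<lambda>\<pi>. f \<pi> i) -` S" using assms by fastforce
      then show "\<exists>n. cylinder n \<pi> \<subseteq> (\<lambda>\<pi>. f \<pi> i) -` S" by blast
    qed
    then show "(\<lambda>\<pi>. f \<pi> i) -` S \<inter> space seq_algebra \<in> sets seq_algebra"
      by (simp add: space_PiM)
  qed simp
qed simp

text \<open>Two cylinders are either nested or disjoint; the empty set is added for the disjoint
  case.\<close>

lemma Int_stable_cylinders: "Int_stable (insert {} cylinders)"
proof (rule Int_stableI)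
  have "cylinder n x \<inter> cylinder m y \<in> insert {} cylinders" if "n \<le> m"
    for n m and x y :: "nat \<Rightarrow> 'b"
  proof (cases "y \<in> cylinder n x")
    case True
    then have "cylinder n x \<inter> cylinder m y = cylinder m y"
      using that by (auto simp: cylinder_def)
    then show ?thesis by (auto simp: cylinders_def)
  next
    case False
    then have "cylinder n x \<inter> cylinder m y = {}"
      using that by (force simp: cylinder_def)
    then show ?thesis by simp
  qed
  then have *: "cylinder n x \<inter> cylinder m y \<in> insert {} cylinders" for n m and x y :: "nat \<Rightarrow> 'b"
    by (metis Int_commute nat_le_linear)
  fix a b :: "(nat \<Rightarrow> 'b) set"
  assume "a \<in> insert {} cylinders" "b \<in> insert {} cylinders"
  then consider "a \<inter> b = {}" | n x m y where "a = cylinder n x" "b = cylinder m y"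
    by (auto simp: cylinders_def)
  then show "a \<inter> b \<in> insert {} cylinders" by cases (use * in simp_all)
qed

text \<open>Dynkin's uniqueness theorem for the pi-system of cylinders. The cylinder of length 0 is
  the whole space and provides the exhausting sequence.\<close>

lemma measure_eqI_cylinders:
  fixes M N :: "(nat \<Rightarrow> 'b::countable) measure"
  assumes "prob_space M" and M: "sets M = sets seq_algebra" and N: "sets N = sets seq_algebra"
    and eq: "\<And>n x. emeasure M (cylinder n x) = emeasure N (cylinder n x)"
  shows "M = N"
proof (rule measure_eqI_generator_eq[where E = "insert {} cylinders" and \<Omega> = UNIV
      and A = "\<lambda>_. UNIV"])
  have gen: "sigma_sets UNIV (insert {} cylinders) = sigma_sets UNIV (cylinders :: (nat \<Rightarrow> 'b) set set)"
    by (intro sigma_sets_eqI) (auto intro: sigma_sets.Empty)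
  show "sets M = sigma_sets UNIV (insert {} cylinders)" "sets N = sigma_sets UNIV (insert {} cylinders)"
    by (simp_all add: gen M N sets_seq_algebra)
  have "UNIV = cylinder 0 undefined" by (simp add: cylinder_def)
  then show "range (\<lambda>_::nat. UNIV) \<subseteq> insert {} (cylinders :: (nat \<Rightarrow> 'b) set set)"
    by (auto simp: cylinders_def)
  show "emeasure M UNIV \<noteq> \<infinity>"
    using finite_measure.emeasure_finite[OF prob_space.finite_measure[OF assms(1)], of UNIV] by simp
qed (use eq Int_stable_cylinders in \<open>auto simp: cylinders_def\<close>)

text \<open>Bridges the Cantor space over a carrier \<open>A\<close> and the sequences over a whole
  type. The relabelling \<open>g\<close> is the observation map for objectives of G and the identity
  for those of H. Induction over the generation of \<open>B\<close>, relative to the set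
  \<open>?D\<close> of sequences whose labels stay in \<open>A\<close>.\<close>

lemma borel_preimage_measurable:
  fixes g :: "'b::countable \<Rightarrow> 'c"
  assumes "B \<in> borel_sets (cantor_topology A)"
  shows "{\<pi> :: nat \<Rightarrow> 'b. (\<forall>i. g (\<pi> i) \<in> A) \<and> (\<lambda>i. g (\<pi> i)) \<in> B} \<in> sets seq_algebra"
proof -
  let ?D = "{\<pi> :: nat \<Rightarrow> 'b. \<forall>i. g (\<pi> i) \<in> A}"
  \<comment> \<open>A single label outside \<open>A\<close> already refutes membership, so
    \<open>?D\<close> is closed.\<close>
  have "- ?D \<in> sets seq_algebra"
  proof (rule union_of_cylinders_measurable)
    fix \<pi> assume "\<pi> \<in> - ?D"
    then obtain i where "g (\<pi> i) \<notin> A" by auto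
    then have "cylinder (Suc i) \<pi> \<subseteq> - ?D" by (auto simp: cylinder_def) (metis lessI)
    then show "\<exists>n. cylinder n \<pi> \<subseteq> - ?D" by blast
  qed
  then have "space seq_algebra - - ?D \<in> sets seq_algebra"
    by (rule sets.compl_sets)
  then have D: "?D \<in> sets seq_algebra"
    by (simp add: space_PiM Compl_eq_Diff_UNIV[symmetric])
  have top: "topspace (cantor_topology A) = {f. \<forall>i. f i \<in> A}"
    by (auto simp: cantor_topology_def)
  have "?D \<inter> {\<pi>. (\<lambda>i. g (\<pi> i)) \<in> B} \<in> sets seq_algebra"
    using assms unfolding borel_sets_def
  proof (induction rule: sigma_sets.induct)
    case (Basic U)
    \<comment> \<open>The preimage of \<open>U\<close> is only open relative to \<open>?D\<close>;
      \<open>?S\<close> is an open set of the full space with the same trace on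
      \<open>?D\<close>.\<close>
    let ?S = "{\<pi>. \<exists>n. \<forall>\<pi>' \<in> cylinder n \<pi> \<inter> ?D. (\<lambda>i. g (\<pi>' i)) \<in> U}"
    have "?S \<in> sets seq_algebra"
    proof (rule union_of_cylinders_measurable)
      fix \<pi> assume "\<pi> \<in> ?S"
      then obtain n where "\<forall>\<pi>' \<in> cylinder n \<pi> \<inter> ?D. (\<lambda>i. g (\<pi>' i)) \<in> U" by blast
      then have "cylinder n \<pi> \<subseteq> ?S" using cylinder_eqI by fastforce
      then show "\<exists>n. cylinder n \<pi> \<subseteq> ?S" by blast
    qed
    moreover have "?D \<inter> {\<pi>. (\<lambda>i. g (\<pi> i)) \<in> U} = ?D \<inter> ?S"
    proof
      show "?D \<inter> ?S \<subseteq> ?D \<inter> {\<pi>. (\<lambda>i. g (\<pi> i)) \<in> U}" using cylinder_self by fastforce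
      show "?D \<inter> {\<pi>. (\<lambda>i. g (\<pi> i)) \<in> U} \<subseteq> ?D \<inter> ?S"
      proof
        fix \<pi> assume \<pi>: "\<pi> \<in> ?D \<inter> {\<pi>. (\<lambda>i. g (\<pi> i)) \<in> U}"
        then obtain V where V: "finite {i. V i \<noteq> A}" "(\<lambda>i. g (\<pi> i)) \<in> PiE UNIV V" "PiE UNIV V \<subseteq> U"
          using Basic by (auto simp: cantor_topology_def openin_product_topology_alt)
        \<comment> \<open>The basic box \<open>V\<close> constrains only coordinates below
          \<open>n\<close>; at the others \<open>V i = A\<close>, which membership in
          \<open>?D\<close> guarantees.\<close>
        from V(1) obtain n where n: "\<And>i. V i \<noteq> A \<Longrightarrow> i < n"
          by (metis (mono_tags, lifting) finite_nat_set_iff_bounded mem_Collect_eq)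
        have "(\<lambda>i. g (\<pi>' i)) \<in> U" if "\<pi>' \<in> cylinder n \<pi> \<inter> ?D" for \<pi>'
        proof -
          have "g (\<pi>' i) \<in> V i" for i
            using that V(2) n[of i] by (cases "V i = A") (auto simp: cylinder_def PiE_iff)
          then show ?thesis using V(3) by (auto simp: PiE_iff)
        qed
        then show "\<pi> \<in> ?D \<inter> ?S" using \<pi> by blast
      qed
    qed
    ultimately show ?case using D by auto
  next
    case Empty
    then show ?case by simp
  next
    case (Compl B)
    \<comment> \<open>Complements are taken among sequences over \<open>A\<close>, so they turn into
      differences from \<open>?D\<close>.\<close>
    have "?D \<inter> {\<pi>. (\<lambda>i. g (\<pi> i)) \<in> topspace (cantor_topology A) - B} =
        ?D - (?D \<inter> {\<pi>. (\<lambda>i. g (\<pi> i)) \<in> B})"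
      by (auto simp: top)
    then show ?case using sets.Diff[OF D Compl.IH] by simp
  next
    case (Union B)
    have "?D \<inter> {\<pi>. (\<lambda>i. g (\<pi> i)) \<in> \<Union> (range B)} = (\<Union>k. ?D \<inter> {\<pi>. (\<lambda>i. g (\<pi> i)) \<in> B k})"
      by auto
    moreover have "(\<Union>k. ?D \<inter> {\<pi>. (\<lambda>i. g (\<pi> i)) \<in> B k}) \<in> sets seq_algebra"
      by (rule sets.countable_UN) (use Union.IH in blast)
    ultimately show ?case by simp
  qed
  then show ?thesis by (simp add: Collect_conj_eq)
qed

section \<open>Measures induced by strategies\<close>

lemma space_play_measure:
  fixes \<alpha> :: "('l::finite, 'a::finite) strat1"
  shows "space (play_measure \<alpha> \<beta> l) = UNIV"
  using sets_eq_imp_space_eq[OF sets_play_measure] by (simp add: space_PiM)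

text \<open>If \<open>\<pi>\<close> fails at \<open>n\<close>, factor \<open>n\<close> of the
  product formula for \<open>cylinder (Suc n) \<pi>\<close> is zero. So every failing sequence lies
  in a null cylinder, and the countable union of these is null.\<close>

lemma AE_play_step:
  fixes \<alpha> :: "('l::finite, 'a::finite) strat1"
  shows "AE \<pi> in play_measure \<alpha> \<beta> l. \<forall>n. \<pi> n \<in> set_pmf (play_step \<alpha> \<beta> l n \<pi>)"
proof (rule AE_I')
  let ?M = "play_measure \<alpha> \<beta> l"
  let ?N = "{C \<in> cylinders. C \<in> null_sets ?M}"
  have "countable ?N"
    by (rule countable_subset[OF _ countable_cylinders]) blast
  then show "(\<Union>C\<in>?N. C) \<in> null_sets ?M"
    by (intro null_sets_UN') auto
  show "{\<pi> \<in> space ?M. \<not> (\<forall>n. \<pi> n \<in> set_pmf (play_step \<alpha> \<beta> l n \<pi>))} \<subseteq> (\<Union>C\<in>?N. C)"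
  proof
    fix \<pi> assume "\<pi> \<in> {\<pi> \<in> space ?M. \<not> (\<forall>n. \<pi> n \<in> set_pmf (play_step \<alpha> \<beta> l n \<pi>))}"
    then obtain n where "\<pi> n \<notin> set_pmf (play_step \<alpha> \<beta> l n \<pi>)" by blast
    then have "pmf (play_step \<alpha> \<beta> l n \<pi>) (\<pi> n) = 0" by (simp add: set_pmf_iff)
    then have "emeasure ?M (cylinder (Suc n) \<pi>) = 0"
      by (simp add: cylinder_def emeasure_play_measure_cylinder del: play_step.simps)
    then have "cylinder (Suc n) \<pi> \<in> null_sets ?M"
      by (simp add: null_sets_def sets_play_measure)
    then show "\<pi> \<in> (\<Union>C\<in>?N. C)"
      using cylinder_self[of \<pi> "Suc n"] by (auto simp: cylinders_def)
  qed
qed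

lemma play_measure_eq_distr:
  fixes \<alpha> :: "('l::finite, 'a::finite) strat1" and \<alpha>' :: "('k::finite, 'b::finite) strat1"
  assumes A: "AE \<pi> in play_measure \<alpha> \<beta> l. \<pi> \<in> A"
    and B: "AE \<pi> in play_measure \<alpha>' \<beta>' l'. \<pi> \<in> f ` A"
    and meas: "f \<in> seq_algebra \<rightarrow>\<^sub>M seq_algebra"
    and agree: "\<And>x y n. x \<in> A \<Longrightarrow> y \<in> A \<Longrightarrow> f x \<in> cylinder n (f y) \<longleftrightarrow> x \<in> cylinder n y"
    and step: "\<And>x n. x \<in> A \<Longrightarrow>
      pmf (play_step \<alpha> \<beta> l n x) (x n) = pmf (play_step \<alpha>' \<beta>' l' n (f x)) (f x n)"
  shows "play_measure \<alpha>' \<beta>' l' = distr (play_measure \<alpha> \<beta> l) seq_algebra f"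
proof (rule measure_eqI_cylinders)
  let ?M = "play_measure \<alpha> \<beta> l" and ?N = "play_measure \<alpha>' \<beta>' l'"
  have meas': "f \<in> ?M \<rightarrow>\<^sub>M seq_algebra"
    using meas by (simp add: measurable_cong_sets[OF sets_play_measure refl])
  fix n x
  have "emeasure (distr ?M seq_algebra f) (cylinder n x) = emeasure ?M (f -` cylinder n x)"
    using meas' by (simp add: emeasure_distr cylinder_in_sets space_play_measure)
  also have "\<dots> = emeasure ?N (cylinder n x)"
  proof (cases "\<exists>z\<in>A. f z \<in> cylinder n x")
    case True
    then obtain z where z: "z \<in> A" "f z \<in> cylinder n x" by blast
    have "f -` cylinder n x \<in> sets ?M"
      using measurable_sets[OF meas' cylinder_in_sets] by (simp add: space_play_measure)
    then have "emeasure ?M (f -` cylinder n x) = emeasure ?M (cylinder n z)"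
      using A agree[OF _ z(1)] cylinder_eqI[OF z(2)]
      by (intro emeasure_eq_AE) (auto simp: sets_play_measure cylinder_in_sets)
    also have "\<dots> = emeasure ?N (cylinder n (f z))"
      using step[OF z(1)] by (simp add: cylinder_def emeasure_play_measure_cylinder)
    finally show ?thesis using cylinder_eqI[OF z(2)] by simp
  next
    case False
    have "AE \<pi> in ?M. \<pi> \<notin> f -` cylinder n x" using A by eventually_elim (use False in auto)
    moreover have "AE \<pi> in ?N. \<pi> \<notin> cylinder n x" using B by eventually_elim (use False in auto)
    ultimately show ?thesis
      using emeasure_eq_0_AE[of "\<lambda>\<pi>. \<pi> \<in> f -` cylinder n x" ?M]
        emeasure_eq_0_AE[of "\<lambda>\<pi>. \<pi> \<in> cylinder n x" ?N]
      by (simp add: space_play_measure vimage_def)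
  qed
  finally show "emeasure ?N (cylinder n x) = emeasure (distr ?M seq_algebra f) (cylinder n x)" ..
qed (simp_all add: prob_space_play_measure sets_play_measure)

section \<open>Weights of single steps\<close>

lemma pmf_bind_Pair:
  fixes p :: "'b::finite pmf"
  shows "pmf (bind_pmf p (\<lambda>x. map_pmf (Pair x) (q x))) (x, y) = pmf p x * pmf (q x) y"
proof -
  have "pmf (map_pmf (Pair z) (q z)) (x, y) = (if z = x then pmf (q x) y else 0)" for z
  proof (cases "z = x")
    case True
    then show ?thesis using pmf_map_inj'[of "Pair x" "q x" y] by (simp add: inj_def)
  next
    case False
    then show ?thesis by (auto simp: pmf_eq_0_set_pmf)
  qed
  then show ?thesis
    by (simp only: pmf_bind) (simp add: integral_measure_pmf[of UNIV] if_distrib cong: if_cong)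
qed

text \<open>Splits a step into Player 2's weight and Player 1's weight, so that each can be
  transferred separately. At time 0 the state is given rather than drawn, hence the factor
  1.\<close>

lemma pmf_play_step:
  fixes \<alpha> :: "('l::finite, 'a) strat1"
  assumes "fst (\<pi> 0) = l"
  shows "pmf (play_step \<alpha> \<beta> l n \<pi>) (\<pi> n) =
    (case n of 0 \<Rightarrow> 1 | Suc m \<Rightarrow> pmf (\<beta> (play_pref \<pi> m) (snd (\<pi> m))) (fst (\<pi> n))) *
    pmf (\<alpha> (play_pref \<pi> n)) (snd (\<pi> n))"
proof (cases n)
  case 0
  have "\<pi> 0 = (l, snd (\<pi> 0))" using assms by (simp add: prod_eq_iff)
  then have "pmf (map_pmf (Pair l) (\<alpha> ([], l))) (\<pi> 0) = pmf (\<alpha> ([], l)) (snd (\<pi> 0))"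
    using pmf_map_inj'[of "Pair l" "\<alpha> ([], l)" "snd (\<pi> 0)"] by (simp add: inj_def)
  then show ?thesis using 0 assms by (simp add: play_pref_def)
next
  case (Suc m)
  then show ?thesis
    using pmf_bind_Pair[of "\<beta> (play_pref \<pi> m) (snd (\<pi> m))" "\<lambda>l'. \<alpha> (map \<pi> [0..<Suc m], l')"
        "fst (\<pi> n)" "snd (\<pi> n)"]
    by (simp add: play_pref_def)
qed

text \<open>The point \<open>x\<close> may have weight zero. Injectivity on \<open>S\<close>, rather
  than on the support alone, prevents a support point from being mapped to \<open>f x\<close> as
  well.\<close>

lemma pmf_map_inj_on_superset:
  assumes "inj_on f S" "set_pmf p \<subseteq> S" "x \<in> S"
  shows "pmf (map_pmf f p) (f x) = pmf p x"
proof (cases "x \<in> set_pmf p")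
  case True
  then show ?thesis using assms by (intro pmf_map_inj) (auto intro: inj_on_subset)
next
  case False
  then have "f x \<notin> f ` set_pmf p" using assms by (auto dest: inj_onD)
  then show ?thesis using False by (metis pmf_eq_0_set_pmf set_map_pmf)
qed

text \<open>Evaluates \<open>g_bar2\<close> and \<open>h_bar2\<close>: once their weight function is
  recognised as that of a known distribution, nonnegativity and total mass 1 come for free.\<close>

lemma embed_pmf_pmf: "embed_pmf (pmf p) = p"
  by (rule type_definition.Rep_inverse[OF td_pmf_embed_pmf])

section \<open>Plays and prefixes of an arena\<close>

lemma play_pref_cong: "\<pi>' \<in> cylinder (Suc n) \<pi> \<Longrightarrow> play_pref \<pi>' n = play_pref \<pi> n"
  by (auto simp: play_pref_def cylinder_def)

lemma play_pref_in_Prefs: "\<pi> \<in> Plays G \<Longrightarrow> play_pref \<pi> n \<in> Prefs G"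
  by (auto simp: Prefs_def)

text \<open>\<open>Prefs\<close> is defined through infinite plays, so over an empty alphabet not
  even the initial prefix exists. With a letter available, totality extends every finite path to a
  play, and prefixes can be built up step by step.\<close>

locale nonblocking_arena =
  fixes G :: "('l, 'a, 'z) arena_scheme"
  assumes arena: "arena G" and alphabet_nonempty: "alphabet G \<noteq> {}"
begin

lemma delta_in_states: "(l, a, l') \<in> delta G \<Longrightarrow> l \<in> states G \<and> a \<in> alphabet G \<and> l' \<in> states G"
  using arena by (auto simp: arena_def)

text \<open>\<open>letter\<close> and \<open>succ\<close> fix one continuation at every state;
  iterating it completes a finite path to a play.\<close>

definition letter :: 'a where "letter = (SOME a. a \<in> alphabet G)"

definition succ :: "'l \<Rightarrow> 'l" where "succ l = (SOME l'. (l, letter, l') \<in> delta G)"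

lemma delta_succ: "l \<in> states G \<Longrightarrow> (l, letter, succ l) \<in> delta G"
proof -
  assume "l \<in> states G"
  moreover have "letter \<in> alphabet G"
    unfolding letter_def using alphabet_nonempty by (simp add: some_in_eq)
  ultimately have "\<exists>l'. (l, letter, l') \<in> delta G" using arena by (auto simp: arena_def)
  then show ?thesis unfolding succ_def by (rule someI_ex)
qed

lemma succ_iterate_in_states: "l \<in> states G \<Longrightarrow> (succ ^^ n) l \<in> states G"
  by (induction n) (auto dest: delta_succ delta_in_states)

lemma Prefs_start: "([], start G) \<in> Prefs G"
proof -
  let ?\<pi> = "\<lambda>i. ((succ ^^ i) (start G), letter)"
  have "start G \<in> states G" using arena by (simp add: arena_def)
  then have "?\<pi> \<in> Plays G"
    using succ_iterate_in_states delta_succ delta_in_states by (fastforce simp: Plays_def)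
  from play_pref_in_Prefs[OF this, of 0] show ?thesis by (simp add: play_pref_def)
qed

lemma Prefs_snoc_iff:
  "(xs @ [(l, a)], l') \<in> Prefs G \<longleftrightarrow> (xs, l) \<in> Prefs G \<and> (l, a, l') \<in> delta G"
proof
  assume "(xs @ [(l, a)], l') \<in> Prefs G"
  then obtain \<pi> n where \<pi>: "\<pi> \<in> Plays G" "(xs @ [(l, a)], l') = play_pref \<pi> n"
    by (auto simp: Prefs_def)
  then obtain m where "n = Suc m" by (cases n) (auto simp: play_pref_def)
  then have "xs = map \<pi> [0..<m]" "\<pi> m = (l, a)" "l' = fst (\<pi> (Suc m))"
    using \<pi>(2) by (auto simp: play_pref_def)
  then have "(xs, l) = play_pref \<pi> m" and "(l, a, l') \<in> delta G"
    using \<pi>(1) by (auto simp: play_pref_def Plays_def) (metis fst_conv snd_conv)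
  then show "(xs, l) \<in> Prefs G \<and> (l, a, l') \<in> delta G"
    using play_pref_in_Prefs[OF \<pi>(1)] by simp
next
  assume *: "(xs, l) \<in> Prefs G \<and> (l, a, l') \<in> delta G"
  then obtain \<pi> n where \<pi>: "\<pi> \<in> Plays G" "(xs, l) = play_pref \<pi> n"
    by (auto simp: Prefs_def)
  \<comment> \<open>The given play is kept before \<open>n\<close>. Its letter at \<open>n\<close>
    may differ from \<open>a\<close>, so that entry is replaced and the tail restarts at
    \<open>l'\<close>, which is iterate 0 at time \<open>Suc n\<close>.\<close>
  let ?\<pi> = "\<lambda>i. if i < n then \<pi> i else if i = n then (l, a) else ((succ ^^ (i - Suc n)) l', letter)"
  have l: "l = fst (\<pi> n)" "xs = map \<pi> [0..<n]" using \<pi>(2) by (auto simp: play_pref_def)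
  have l': "(l, a, l') \<in> delta G" "l' \<in> states G" using * delta_in_states by auto
  have "(fst (?\<pi> i), snd (?\<pi> i), fst (?\<pi> (Suc i))) \<in> delta G" for i
  proof -
    consider "Suc i < n" | "Suc i = n" | "i = n" | "i > n" by linarith
    then show ?thesis
    proof cases
      case 4
      then have "Suc i - Suc n = Suc (i - Suc n)" by simp
      then show ?thesis using 4 delta_succ[OF succ_iterate_in_states[OF l'(2)]] by simp
    qed (use \<pi>(1) l l' in \<open>auto simp: Plays_def\<close>)
  qed
  moreover have "fst (?\<pi> 0) = start G" using \<pi>(1) l by (auto simp: Plays_def)
  ultimately have "?\<pi> \<in> Plays G"
    using delta_in_states unfolding Plays_def by blast
  then have "play_pref ?\<pi> (Suc n) \<in> Prefs G" by (rule play_pref_in_Prefs)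
  moreover have "play_pref ?\<pi> (Suc n) = (xs @ [(l, a)], l')"
    using l by (simp add: play_pref_def)
  ultimately show "(xs @ [(l, a)], l') \<in> Prefs G" by simp
qed

lemma Prefs_Nil_iff: "([], l) \<in> Prefs G \<longleftrightarrow> l = start G"
  using Prefs_start by (auto simp: Prefs_def play_pref_def Plays_def)

lemma play_pref_Suc_in_Prefs_iff:
  "play_pref \<pi> (Suc n) \<in> Prefs G \<longleftrightarrow>
    play_pref \<pi> n \<in> Prefs G \<and> (fst (\<pi> n), snd (\<pi> n), fst (\<pi> (Suc n))) \<in> delta G"
  using Prefs_snoc_iff[of "map \<pi> [0..<n]" "fst (\<pi> n)" "snd (\<pi> n)" "fst (\<pi> (Suc n))"]
  by (simp add: play_pref_def)

text \<open>The plays form a closed set: a sequence that is no play is refuted by a finite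
  prefix.\<close>

lemma Plays_iff: "\<pi> \<in> Plays G \<longleftrightarrow> (\<forall>n. play_pref \<pi> n \<in> Prefs G)"
proof
  assume *: "\<forall>n. play_pref \<pi> n \<in> Prefs G"
  have "(fst (\<pi> n), snd (\<pi> n), fst (\<pi> (Suc n))) \<in> delta G" for n
    using * play_pref_Suc_in_Prefs_iff by blast
  moreover have "fst (\<pi> 0) = start G"
    using *[rule_format, of 0] by (simp add: play_pref_def Prefs_Nil_iff)
  ultimately show "\<pi> \<in> Plays G" using delta_in_states unfolding Plays_def by blast
qed (simp add: play_pref_in_Prefs)

lemma Last_in_states: "\<rho> \<in> Prefs G \<Longrightarrow> Last \<rho> \<in> states G"
  by (auto simp: Prefs_def play_pref_def Plays_def)

lemma play_step_imp_Plays: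
  assumes "strategy1 G \<alpha>" "strategy2 G \<beta>"
    and step: "\<And>n. \<pi> n \<in> set_pmf (play_step \<alpha> \<beta> (start G) n \<pi>)"
  shows "\<pi> \<in> Plays G"
proof -
  \<comment> \<open>The letter has to be carried through the induction, as \<open>strategy2\<close>
    constrains Player 2 only after letters of the alphabet.\<close>
  have "play_pref \<pi> n \<in> Prefs G \<and> snd (\<pi> n) \<in> alphabet G" for n
  proof (induction n)
    case 0
    then show ?case
      using step[of 0] Prefs_start assms(1) by (fastforce simp: play_pref_def strategy1_def)
  next
    case (Suc n)
    have b: "fst (\<pi> (Suc n)) \<in> set_pmf (\<beta> (play_pref \<pi> n) (snd (\<pi> n)))"
      and a: "snd (\<pi> (Suc n)) \<in> set_pmf (\<alpha> (play_pref \<pi> (Suc n)))"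
      using step[of "Suc n"] by (auto simp: play_pref_def)
    have "(fst (\<pi> n), snd (\<pi> n), fst (\<pi> (Suc n))) \<in> delta G"
      using b Suc assms(2) by (fastforce simp: strategy2_def play_pref_def)
    then have "play_pref \<pi> (Suc n) \<in> Prefs G" using Suc by (simp add: play_pref_Suc_in_Prefs_iff)
    then show ?case using a assms(1) by (auto simp: strategy1_def)
  qed
  then show ?thesis by (simp add: Plays_iff)
qed

end

lemma Plays_measurable:
  fixes G :: "('l::finite, 'a::finite, 'z) arena_scheme"
  assumes "nonblocking_arena G"
  shows "Plays G \<in> sets seq_algebra"
proof -
  interpret nonblocking_arena G by fact
  have "- Plays G \<in> sets seq_algebra"
  proof (rule union_of_cylinders_measurable)
    fix \<pi> assume "\<pi> \<in> - Plays G"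
    then obtain n where "play_pref \<pi> n \<notin> Prefs G" by (auto simp: Plays_iff)
    then have "cylinder (Suc n) \<pi> \<subseteq> - Plays G"
      by (metis (no_types, lifting) ComplI Plays_iff play_pref_cong subsetI)
    then show "\<exists>n. cylinder n \<pi> \<subseteq> - Plays G" by blast
  qed
  then have "space seq_algebra - - Plays G \<in> sets seq_algebra" by (rule sets.compl_sets)
  then show ?thesis by (simp add: space_PiM Compl_eq_Diff_UNIV[symmetric])
qed

lemma AE_Plays:
  fixes G :: "('l::finite, 'a::finite, 'z) arena_scheme"
  assumes "nonblocking_arena G" "strategy1 G \<alpha>" "strategy2 G \<beta>"
  shows "AE \<pi> in play_measure \<alpha> \<beta> (start G). \<pi> \<in> Plays G"
  using AE_play_step
  by eventually_elim (use nonblocking_arena.play_step_imp_Plays[OF assms] in blast)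

section \<open>The knowledge-based subset construction\<close>

definition proj_play :: "('l set \<times> 'l, 'a) play \<Rightarrow> ('l, 'a) play" where
  "proj_play \<sigma> = (\<lambda>i. (snd (fst (\<sigma> i)), snd (\<sigma> i)))"

text \<open>Valid for arbitrary sequences, not just plays, so \<open>h_play G\<close> is injective
  on the whole sequence space.\<close>

lemma proj_play_h_play: "proj_play (h_play G \<pi>) = \<pi>"
  by (simp add: proj_play_def h_play_def)

lemma pref_upto_play_pref: "i \<le> n \<Longrightarrow> pref_upto (play_pref \<pi> n) i = play_pref \<pi> i"
  by (auto simp: pref_upto_def pref_state_def play_pref_def nth_append take_map)

lemma pref_state_play_pref: "i \<le> n \<Longrightarrow> pref_state (play_pref \<pi> n) i = fst (\<pi> i)"
  by (auto simp: pref_state_def play_pref_def nth_append)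

text \<open>The knowledge attached at \<open>i\<close> depends only on the prefix up to
  \<open>i\<close>, so truncation commutes with h. From here on \<open>h_pref\<close> is handled
  through the simpler \<open>h_play\<close>.\<close>

lemma h_pref_play_pref: "h_pref G (play_pref \<pi> n) = play_pref (h_play G \<pi>) n"
proof -
  have "length (fst (play_pref \<pi> n)) = n" "\<And>i. i < n \<Longrightarrow> fst (play_pref \<pi> n) ! i = \<pi> i"
    by (simp_all add: play_pref_def)
  then show ?thesis
    unfolding play_pref_def[of "h_play G \<pi>"]
    by (auto simp: h_pref_def Let_def pref_upto_play_pref pref_state_play_pref h_play_def)
qed

lemma inj_on_h_pref: "inj_on (h_pref G) (Prefs G)"
proof (rule inj_on_inverseI)
  fix \<rho> assume "\<rho> \<in> Prefs G"
  then obtain \<pi> n where "\<rho> = play_pref \<pi> n" by (auto simp: Prefs_def)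
  then show "(\<lambda>(xs, q). (map (\<lambda>(q, a). (snd q, a)) xs, snd q)) (h_pref G \<rho>) = \<rho>"
    by (simp add: h_pref_play_pref) (simp add: play_pref_def h_play_def)
qed

lemma h_play_cong:
  assumes "\<pi>' \<in> cylinder (Suc i) \<pi>"
  shows "h_play G \<pi>' i = h_play G \<pi> i"
  using assms play_pref_cong[OF assms] by (simp add: h_play_def cylinder_def)

lemma h_play_in_cylinder_iff: "h_play G x \<in> cylinder n (h_play G y) \<longleftrightarrow> x \<in> cylinder n y"
proof
  assume "h_play G x \<in> cylinder n (h_play G y)"
  then have "proj_play (h_play G x) \<in> cylinder n (proj_play (h_play G y))"
    by (simp add: cylinder_def proj_play_def)
  then show "x \<in> cylinder n y" by (simp add: proj_play_h_play)
next
  assume "x \<in> cylinder n y"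
  then have "x \<in> cylinder (Suc i) y" if "i < n" for i using that by (auto simp: cylinder_def)
  then show "h_play G x \<in> cylinder n (h_play G y)"
    using h_play_cong unfolding cylinder_def by blast
qed

section \<open>The subset construction for a game with at least one letter\<close>

locale knowledge_game =
  fixes G :: "('l::finite, 'a::finite, 'o) obs_arena"
  assumes game: "game_structure G" and letters: "alphabet G \<noteq> {}"
begin

sublocale G: nonblocking_arena G
  using game letters by unfold_locales (auto simp: game_structure_def)

lemma state_obs_eq: "x \<in> observations G \<Longrightarrow> l \<in> gam G x \<Longrightarrow> state_obs G l = x"
  using game unfolding state_obs_def game_structure_def disjoint_family_on_def
  by (intro the_equality) auto

lemma state_obs_in:
  assumes "l \<in> states G"
  shows "state_obs G l \<in> observations G" "l \<in> gam G (state_obs G l)"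
proof -
  obtain x where "x \<in> observations G" "l \<in> gam G x"
    using assms game by (auto simp: game_structure_def)
  then show "state_obs G l \<in> observations G" "l \<in> gam G (state_obs G l)"
    using state_obs_eq by auto
qed

lemma states_Knw_iff:
  "(s, l) \<in> states (Knw G) \<longleftrightarrow> (\<exists>x\<in>observations G. s \<subseteq> gam G x) \<and> l \<in> s"
  by (simp add: Knw_def Let_def)

lemma alphabet_Knw: "alphabet (Knw G) = alphabet G"
  by (simp add: Knw_def Let_def)

lemma start_Knw: "start (Knw G) = ({start G}, start G)"
  by (simp add: Knw_def Let_def)

text \<open>The observation in the definition of Knw(G) is forced: \<open>l'\<close> lies in
  \<open>s'\<close>, hence in the chosen cell of the partition. So \<open>s'\<close> is a function
  of \<open>s\<close>, \<open>a\<close> and \<open>l'\<close>.\<close>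

lemma delta_Knw_iff:
  "((s, l), a, (s', l')) \<in> delta (Knw G) \<longleftrightarrow>
    (s, l) \<in> states (Knw G) \<and> (l, a, l') \<in> delta G \<and> s' = Post G a s \<inter> gam G (state_obs G l')"
proof
  assume "((s, l), a, (s', l')) \<in> delta (Knw G)"
  then show "(s, l) \<in> states (Knw G) \<and> (l, a, l') \<in> delta G \<and> s' = Post G a s \<inter> gam G (state_obs G l')"
    using state_obs_eq by (auto simp: Knw_def Let_def)
next
  assume *: "(s, l) \<in> states (Knw G) \<and> (l, a, l') \<in> delta G \<and> s' = Post G a s \<inter> gam G (state_obs G l')"
  then have "l' \<in> states G" "a \<in> alphabet G" using G.delta_in_states by auto
  moreover have "l' \<in> Post G a s" using * by (auto simp: Post_def states_Knw_iff)
  ultimately show "((s, l), a, (s', l')) \<in> delta (Knw G)"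
    using * state_obs_in[of l'] by (auto simp: Knw_def Let_def)
qed

lemma inj_on_snd_successors: "inj_on snd {q'. (q, a, q') \<in> delta (Knw G)}"
  by (cases q) (auto simp: inj_on_def delta_Knw_iff)

lemma arena_Knw: "arena (Knw G)"
  unfolding arena_def
proof (intro conjI ballI)
  have "start G \<in> states G" using G.arena by (simp add: arena_def)
  then show "start (Knw G) \<in> states (Knw G)"
    using state_obs_in by (auto simp: start_Knw states_Knw_iff)
  show "delta (Knw G) \<subseteq> states (Knw G) \<times> alphabet (Knw G) \<times> states (Knw G)"
    by (auto simp: Knw_def Let_def)
  fix q a assume q: "q \<in> states (Knw G)" and a: "a \<in> alphabet (Knw G)"
  obtain s l where sl: "q = (s, l)" by (cases q)
  have "l \<in> states G" using q sl game by (auto simp: states_Knw_iff game_structure_def)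
  then obtain l' where "(l, a, l') \<in> delta G"
    using a G.arena by (auto simp: alphabet_Knw arena_def dest!: bspec)
  then have "(q, a, (Post G a s \<inter> gam G (state_obs G l'), l')) \<in> delta (Knw G)"
    using q sl by (simp add: delta_Knw_iff)
  then show "\<exists>q'. (q, a, q') \<in> delta (Knw G)" by blast
qed (simp_all add: alphabet_Knw)

sublocale H: nonblocking_arena "Knw G"
  using arena_Knw letters by unfold_locales (simp_all add: alphabet_Knw)

lemma Knowledge_start: "Knowledge G (pref_obs G ([], start G)) = {start G}"
proof -
  have "Last \<rho> = start G" if "\<rho> \<in> Prefs G" "pref_obs G \<rho> = pref_obs G ([], start G)" for \<rho>
    using that G.Prefs_Nil_iff by (cases \<rho>) (auto simp: pref_obs_def)
  then show ?thesis using G.Prefs_start by (force simp: Knowledge_def)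
qed

text \<open>A prefix with the longer observation sequence is one with the shorter sequence, followed
  by an \<open>a\<close>-step into the cell of \<open>l'\<close>. This recursion is exactly the
  transition rule of Knw(G).\<close>

lemma Knowledge_snoc:
  assumes "(xs @ [(l, a)], l') \<in> Prefs G"
  shows "Knowledge G (pref_obs G (xs @ [(l, a)], l')) =
    Post G a (Knowledge G (pref_obs G (xs, l))) \<inter> gam G (state_obs G l')"
proof (intro equalityI subsetI)
  fix m' assume "m' \<in> Knowledge G (pref_obs G (xs @ [(l, a)], l'))"
  then obtain zs where zs: "(zs, m') \<in> Prefs G"
      "pref_obs G (zs, m') = pref_obs G (xs @ [(l, a)], l')"
    by (auto simp: Knowledge_def)
  then have "zs \<noteq> []" by (auto simp: pref_obs_def)
  then obtain ys m b where ys: "zs = ys @ [(m, b)]" by (metis rev_exhaust surj_pair)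
  then have eq: "pref_obs G (ys, m) = pref_obs G (xs, l)" "b = a" "state_obs G m' = state_obs G l'"
    using zs(2) by (auto simp: pref_obs_def)
  have m: "(ys, m) \<in> Prefs G" "(m, a, m') \<in> delta G"
    using zs(1) ys eq(2) by (simp_all add: G.Prefs_snoc_iff)
  then have "m \<in> Knowledge G (pref_obs G (xs, l))" using eq(1) by (force simp: Knowledge_def)
  moreover have "m' \<in> gam G (state_obs G l')"
    using state_obs_in(2)[of m'] eq(3) G.delta_in_states[OF m(2)] by simp
  ultimately show "m' \<in> Post G a (Knowledge G (pref_obs G (xs, l))) \<inter> gam G (state_obs G l')"
    using m(2) by (auto simp: Post_def)
next
  fix m' assume m': "m' \<in> Post G a (Knowledge G (pref_obs G (xs, l))) \<inter> gam G (state_obs G l')"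
  then obtain ys m where ys: "(ys, m) \<in> Prefs G" "pref_obs G (ys, m) = pref_obs G (xs, l)"
      "(m, a, m') \<in> delta G"
    by (auto simp: Post_def Knowledge_def)
  have "l' \<in> states G" using G.Last_in_states[OF assms] by simp
  \<comment> \<open>Lying in the same cell of the partition means having the same
    observation.\<close>
  then have "state_obs G m' = state_obs G l'" using m' state_obs_in state_obs_eq by blast
  then have "pref_obs G (ys @ [(m, a)], m') = pref_obs G (xs @ [(l, a)], l')"
    using ys(2) by (simp add: pref_obs_def)
  moreover have "(ys @ [(m, a)], m') \<in> Prefs G" using ys by (simp add: G.Prefs_snoc_iff)
  ultimately show "m' \<in> Knowledge G (pref_obs G (xs @ [(l, a)], l'))"
    by (force simp: Knowledge_def)
qed

lemma Knowledge_play_pref_Suc: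
  assumes "\<pi> \<in> Plays G"
  shows "Knowledge G (pref_obs G (play_pref \<pi> (Suc n))) =
    Post G (snd (\<pi> n)) (Knowledge G (pref_obs G (play_pref \<pi> n))) \<inter>
      gam G (state_obs G (fst (\<pi> (Suc n))))"
  using Knowledge_snoc[of "map \<pi> [0..<n]" "fst (\<pi> n)" "snd (\<pi> n)" "fst (\<pi> (Suc n))"]
    play_pref_in_Prefs[OF assms, of "Suc n"]
  by (simp add: play_pref_def)

lemma Knowledge_in_states_Knw:
  assumes "\<rho> \<in> Prefs G"
  shows "(Knowledge G (pref_obs G \<rho>), Last \<rho>) \<in> states (Knw G)"
  unfolding states_Knw_iff
proof
  have "state_obs G (Last \<rho>') = state_obs G (Last \<rho>)" if "pref_obs G \<rho>' = pref_obs G \<rho>" for \<rho>'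
    using that by (simp add: pref_obs_def)
  then have "Knowledge G (pref_obs G \<rho>) \<subseteq> gam G (state_obs G (Last \<rho>))"
    using state_obs_in(2)[OF G.Last_in_states] by (fastforce simp: Knowledge_def)
  then show "\<exists>x\<in>observations G. Knowledge G (pref_obs G \<rho>) \<subseteq> gam G x"
    using state_obs_in(1)[OF G.Last_in_states[OF assms]] by blast
  show "Last \<rho> \<in> Knowledge G (pref_obs G \<rho>)" using assms unfolding Knowledge_def by blast
qed

lemma h_play_in_Plays:
  assumes "\<pi> \<in> Plays G"
  shows "h_play G \<pi> \<in> Plays (Knw G)"
proof -
  have "(fst (h_play G \<pi> n), snd (h_play G \<pi> n), fst (h_play G \<pi> (Suc n))) \<in> delta (Knw G)" for n
    using assms Knowledge_in_states_Knw[OF play_pref_in_Prefs[OF assms, of n]]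
      Knowledge_play_pref_Suc[OF assms, of n]
    by (simp add: h_play_def delta_Knw_iff Plays_def play_pref_def)
  moreover have "fst (h_play G \<pi> 0) = start (Knw G)"
    using assms Knowledge_start by (simp add: h_play_def start_Knw Plays_def play_pref_def)
  ultimately show ?thesis using H.delta_in_states unfolding Plays_def by blast
qed

lemma proj_play_in_Plays:
  assumes "\<sigma> \<in> Plays (Knw G)"
  shows "proj_play \<sigma> \<in> Plays G"
proof -
  have "(snd (fst (\<sigma> n)), snd (\<sigma> n), snd (fst (\<sigma> (Suc n)))) \<in> delta G" for n
    using assms delta_Knw_iff[of "fst (fst (\<sigma> n))" "snd (fst (\<sigma> n))" "snd (\<sigma> n)"
        "fst (fst (\<sigma> (Suc n)))" "snd (fst (\<sigma> (Suc n)))"]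
    by (simp add: Plays_def)
  moreover have "snd (fst (\<sigma> 0)) = start G" using assms by (simp add: Plays_def start_Knw)
  ultimately show ?thesis using G.delta_in_states by (fastforce simp: Plays_def proj_play_def)
qed

text \<open>The set components of a play of Knw(G) obey the same recursion, from the same initial
  value, as the knowledge along its projection.\<close>

lemma h_play_proj_play:
  assumes "\<sigma> \<in> Plays (Knw G)"
  shows "h_play G (proj_play \<sigma>) = \<sigma>"
proof -
  have "Knowledge G (pref_obs G (play_pref (proj_play \<sigma>) n)) = fst (fst (\<sigma> n))" for n
  proof (induction n)
    case 0
    then show ?case
      using assms Knowledge_start by (simp add: Plays_def start_Knw play_pref_def proj_play_def)
  next
    case (Suc n)
    have "fst (fst (\<sigma> (Suc n))) =
        Post G (snd (\<sigma> n)) (fst (fst (\<sigma> n))) \<inter> gam G (state_obs G (snd (fst (\<sigma> (Suc n)))))"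
      using assms delta_Knw_iff[of "fst (fst (\<sigma> n))" "snd (fst (\<sigma> n))" "snd (\<sigma> n)"
          "fst (fst (\<sigma> (Suc n)))" "snd (fst (\<sigma> (Suc n)))"]
      by (simp add: Plays_def)
    then show ?case
      using Knowledge_play_pref_Suc[OF proj_play_in_Plays[OF assms], of n] Suc
      by (simp add: proj_play_def)
  qed
  then show ?thesis by (simp add: h_play_def proj_play_def fun_eq_iff prod_eq_iff)
qed

lemma h_play_image_Plays: "h_play G ` Plays G = Plays (Knw G)"
proof
  show "Plays (Knw G) \<subseteq> h_play G ` Plays G"
    using h_play_proj_play[symmetric] proj_play_in_Plays by (intro subsetI image_eqI)
qed (use h_play_in_Plays in blast)

lemma h_pref_image_Prefs: "h_pref G ` Prefs G = Prefs (Knw G)"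
proof (intro equalityI subsetI)
  fix \<rho> assume "\<rho> \<in> h_pref G ` Prefs G"
  then show "\<rho> \<in> Prefs (Knw G)"
    using h_play_in_Plays by (force simp: Prefs_def h_pref_play_pref)
next
  fix \<rho> assume "\<rho> \<in> Prefs (Knw G)"
  then obtain \<sigma> n where "\<rho> = play_pref \<sigma> n" "\<sigma> \<in> Plays (Knw G)" by (auto simp: Prefs_def)
  then have "\<rho> = h_pref G (play_pref (proj_play \<sigma>) n)" "proj_play \<sigma> \<in> Plays G"
    using h_play_proj_play proj_play_in_Plays by (simp_all add: h_pref_play_pref)
  then show "\<rho> \<in> h_pref G ` Prefs G" using play_pref_in_Prefs by blast
qed

lemma h_pref_in_Prefs: "\<rho> \<in> Prefs G \<Longrightarrow> h_pref G \<rho> \<in> Prefs (Knw G)"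
  using h_pref_image_Prefs by blast

lemma Last_h_pref:
  assumes "\<rho> \<in> Prefs G"
  shows "Last (h_pref G \<rho>) = (Knowledge G (pref_obs G \<rho>), Last \<rho>)"
proof -
  obtain \<pi> n where "\<rho> = play_pref \<pi> n" using assms by (auto simp: Prefs_def)
  then show ?thesis by (simp add: h_pref_play_pref) (simp add: play_pref_def h_play_def)
qed

text \<open>Legality of \<open>\<alpha>\<close> and \<open>\<beta>\<close> in G follows from that of
  \<open>\<alpha>'\<close> and \<open>\<beta>'\<close> through the two linking hypotheses. Player
  1's weights agree by the first of them, Player 2's because \<open>snd\<close> is injective on the
  successors of a state of Knw(G).\<close>

lemma play_measure_Knw:
  assumes \<alpha>': "strategy1 (Knw G) \<alpha>'" and \<beta>': "strategy2 (Knw G) \<beta>'"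
    and \<alpha>: "\<And>\<rho>. \<rho> \<in> Prefs G \<Longrightarrow> \<alpha> \<rho> = \<alpha>' (h_pref G \<rho>)"
    and \<beta>: "\<And>\<rho> a. \<rho> \<in> Prefs G \<Longrightarrow> a \<in> alphabet G \<Longrightarrow> \<beta> \<rho> a = map_pmf snd (\<beta>' (h_pref G \<rho>) a)"
  shows "play_measure \<alpha>' \<beta>' (start (Knw G)) =
    distr (play_measure \<alpha> \<beta> (start G)) seq_algebra (h_play G)"
proof (rule play_measure_eq_distr)
  have succ: "set_pmf (\<beta>' (h_pref G \<rho>) a) \<subseteq> {q'. (Last (h_pref G \<rho>), a, q') \<in> delta (Knw G)}"
    if "\<rho> \<in> Prefs G" "a \<in> alphabet G" for \<rho> a
    using that \<beta>' h_pref_in_Prefs by (simp add: strategy2_def alphabet_Knw)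
  have "strategy1 G \<alpha>"
    using \<alpha>' \<alpha> h_pref_in_Prefs by (simp add: strategy1_def alphabet_Knw)
  moreover have "strategy2 G \<beta>"
    unfolding strategy2_def
  proof (intro ballI subsetI)
    fix \<rho> a l' assume \<rho>: "\<rho> \<in> Prefs G" and a: "a \<in> alphabet G" and "l' \<in> set_pmf (\<beta> \<rho> a)"
    then obtain s' where "(Last (h_pref G \<rho>), a, (s', l')) \<in> delta (Knw G)"
      using \<beta>[OF \<rho> a] succ[OF \<rho> a] by auto
    then show "l' \<in> {l'. (Last \<rho>, a, l') \<in> delta G}"
      using \<rho> by (simp add: Last_h_pref delta_Knw_iff)
  qed
  ultimately show "AE \<pi> in play_measure \<alpha> \<beta> (start G). \<pi> \<in> Plays G"
    by (rule AE_Plays[OF G.nonblocking_arena_axioms])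
  show "AE \<sigma> in play_measure \<alpha>' \<beta>' (start (Knw G)). \<sigma> \<in> h_play G ` Plays G"
    using AE_Plays[OF H.nonblocking_arena_axioms \<alpha>' \<beta>'] by (simp add: h_play_image_Plays)
  show "h_play G \<in> seq_algebra \<rightarrow>\<^sub>M seq_algebra"
    by (rule measurable_seqI) (rule h_play_cong)
  fix \<pi> n assume \<pi>: "\<pi> \<in> Plays G"
  have "pmf (\<beta> (play_pref \<pi> m) (snd (\<pi> m))) (fst (\<pi> (Suc m))) =
      pmf (\<beta>' (play_pref (h_play G \<pi>) m) (snd (\<pi> m))) (fst (h_play G \<pi> (Suc m)))" for m
  proof -
    have a: "snd (\<pi> m) \<in> alphabet G" using \<pi> by (simp add: Plays_def)
    have "(fst (h_play G \<pi> m), snd (h_play G \<pi> m), fst (h_play G \<pi> (Suc m))) \<in> delta (Knw G)"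
      using h_play_in_Plays[OF \<pi>] by (simp add: Plays_def)
    then have "fst (h_play G \<pi> (Suc m)) \<in>
        {q'. (Last (h_pref G (play_pref \<pi> m)), snd (\<pi> m), q') \<in> delta (Knw G)}"
      by (simp add: h_pref_play_pref) (simp add: play_pref_def h_play_def)
    \<comment> \<open>The next state of the image play is a legal successor but may lie outside the
      support of \<open>\<beta>'\<close>.\<close>
    from pmf_map_inj_on_superset[OF inj_on_snd_successors succ[OF play_pref_in_Prefs[OF \<pi>] a] this]
    show ?thesis
      using \<beta>[OF play_pref_in_Prefs[OF \<pi>] a] by (simp add: h_pref_play_pref h_play_def)
  qed
  moreover have "fst (\<pi> 0) = start G" "fst (h_play G \<pi> 0) = start (Knw G)"
    using \<pi> h_play_in_Plays[OF \<pi>] by (simp_all add: Plays_def)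
  moreover have "\<And>m. snd (h_play G \<pi> m) = snd (\<pi> m)" by (simp add: h_play_def)
  ultimately show "pmf (play_step \<alpha> \<beta> (start G) n \<pi>) (\<pi> n) =
      pmf (play_step \<alpha>' \<beta>' (start (Knw G)) n (h_play G \<pi>)) (h_play G \<pi> n)"
    using \<alpha>[OF play_pref_in_Prefs[OF \<pi>]]
    by (simp add: pmf_play_step h_pref_play_pref split: nat.split)
qed (rule h_play_in_cylinder_iff)

section \<open>Translated strategies and objectives\<close>

lemma h_pref_inv_h_pref: "\<rho> \<in> Prefs G \<Longrightarrow> h_pref_inv G (h_pref G \<rho>) = \<rho>"
  by (rule inv_into_f_f[OF inj_on_h_pref])

text \<open>\<open>?f\<close> attaches the updated knowledge to the state drawn in G. It is
  injective, since it keeps that state, and it maps the support into the successors in Knw(G);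
  outside these both weight functions vanish.\<close>

lemma h_bar2_eq:
  assumes \<beta>: "strategy2 G \<beta>" and \<rho>: "\<rho> \<in> Prefs G" and a: "a \<in> alphabet G"
  shows "h_bar2 G \<beta> (h_pref G \<rho>) a =
    map_pmf (\<lambda>l'. (Post G a (Knowledge G (pref_obs G \<rho>)) \<inter> gam G (state_obs G l'), l')) (\<beta> \<rho> a)"
    (is "_ = map_pmf ?f _")
proof -
  have "(if (Last (h_pref G \<rho>), a, q') \<in> delta (Knw G) then pmf (\<beta> \<rho> a) (snd q') else 0) =
      pmf (map_pmf ?f (\<beta> \<rho> a)) q'" for q'
  proof (cases "(Last (h_pref G \<rho>), a, q') \<in> delta (Knw G)")
    case True
    then have "q' = ?f (snd q')"
      using \<rho> by (cases q') (simp add: Last_h_pref delta_Knw_iff)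
    then show ?thesis
      using True pmf_map_inj'[of ?f "\<beta> \<rho> a" "snd q'"] by (simp add: inj_def)
  next
    case False
    have "(Last (h_pref G \<rho>), a, ?f l') \<in> delta (Knw G)" if "l' \<in> set_pmf (\<beta> \<rho> a)" for l'
      using that \<beta> \<rho> a Knowledge_in_states_Knw[OF \<rho>]
      by (auto simp: Last_h_pref delta_Knw_iff strategy2_def)
    then have "q' \<notin> set_pmf (map_pmf ?f (\<beta> \<rho> a))" using False by auto
    then show ?thesis using False by (simp add: pmf_eq_0_set_pmf del: set_map_pmf)
  qed
  then show ?thesis
    unfolding h_bar2_def h_pref_inv_h_pref[OF \<rho>] by (simp only: embed_pmf_pmf)
qed

text \<open>At most one successor in Knw(G) projects to a given \<open>l'\<close>. The image weight
  at \<open>l'\<close> is therefore the weight of that one successor, which the definite description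
  selects.\<close>

lemma g_bar2_eq:
  assumes \<beta>: "strategy2 (Knw G) \<beta>" and \<rho>: "\<rho> \<in> Prefs G" and a: "a \<in> alphabet G"
  shows "g_bar2 G \<beta> \<rho> a = map_pmf snd (\<beta> (h_pref G \<rho>) a)"
proof -
  let ?q = "(Knowledge G (pref_obs G \<rho>), Last \<rho>)" and ?p = "\<beta> (h_pref G \<rho>) a"
  have succ: "set_pmf ?p \<subseteq> {q'. (?q, a, q') \<in> delta (Knw G)}"
    using \<beta> a h_pref_in_Prefs[OF \<rho>] unfolding strategy2_def Last_h_pref[OF \<rho>, symmetric]
    by (simp add: alphabet_Knw)
  have "(if \<exists>s'. (?q, a, (s', l')) \<in> delta (Knw G)
      then pmf ?p (THE s'. (?q, a, (s', l')) \<in> delta (Knw G), l') else 0) =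
      pmf (map_pmf snd ?p) l'" for l'
  proof (cases "\<exists>s'. (?q, a, (s', l')) \<in> delta (Knw G)")
    case True
    then obtain s' where s': "(?q, a, (s', l')) \<in> delta (Knw G)" by blast
    then have "(THE s'. (?q, a, (s', l')) \<in> delta (Knw G)) = s'"
      by (intro the_equality) (auto simp: delta_Knw_iff)
    then show ?thesis
      using True s' pmf_map_inj_on_superset[OF inj_on_snd_successors succ, of "(s', l')"] by simp
  next
    case False
    then have "l' \<notin> set_pmf (map_pmf snd ?p)" using succ by auto
    then show ?thesis using False by (simp add: pmf_eq_0_set_pmf del: set_map_pmf)
  qed
  then show ?thesis unfolding g_bar2_def Let_def by (simp only: embed_pmf_pmf)
qed

lemma strategy1_h_bar1:
  assumes "strategy1 G \<alpha>"
  shows "strategy1 (Knw G) (h_bar1 G \<alpha>)"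
  using assms unfolding strategy1_def h_pref_image_Prefs[symmetric]
  by (simp add: h_bar1_def h_pref_inv_h_pref alphabet_Knw)

lemma strategy2_h_bar2:
  assumes "strategy2 G \<beta>"
  shows "strategy2 (Knw G) (h_bar2 G \<beta>)"
  unfolding strategy2_def h_pref_image_Prefs[symmetric]
proof (intro ballI subsetI, elim imageE)
  fix \<rho>' \<rho> a q'
  assume *: "\<rho>' = h_pref G \<rho>" "\<rho> \<in> Prefs G" "a \<in> alphabet (Knw G)" "q' \<in> set_pmf (h_bar2 G \<beta> \<rho>' a)"
  then have a: "a \<in> alphabet G" by (simp add: alphabet_Knw)
  then obtain l' where l': "l' \<in> set_pmf (\<beta> \<rho> a)"
      "q' = (Post G a (Knowledge G (pref_obs G \<rho>)) \<inter> gam G (state_obs G l'), l')"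
    using * by (auto simp: h_bar2_eq[OF assms])
  have "(Last \<rho>, a, l') \<in> delta G" using l'(1) assms *(2) a by (auto simp: strategy2_def)
  then show "q' \<in> {q'. (Last \<rho>', a, q') \<in> delta (Knw G)}"
    using *(1,2) l'(2) Knowledge_in_states_Knw[OF *(2)] by (simp add: Last_h_pref delta_Knw_iff)
qed

text \<open>An image measure is evaluated on preimages, while the claim concerns the image of
  \<open>\<phi>\<close>. That image is measurable as a preimage under \<open>proj_play\<close> cut
  down to plays, and by injectivity its preimage under \<open>h_play G\<close> is
  \<open>\<phi>\<close> again.\<close>

lemma measure_h_image:
  assumes \<phi>: "borel_obs_objective G \<phi>" and \<alpha>: "strategy1 G \<alpha>" and \<beta>: "strategy2 G \<beta>"
  shows "measure (play_measure \<alpha> \<beta> (start G)) \<phi> =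
    measure (play_measure (h_bar1 G \<alpha>) (h_bar2 G \<beta>) (start (Knw G))) (h_play G ` \<phi>)"
proof -
  let ?M = "play_measure \<alpha> \<beta> (start G)" and ?N = "play_measure (h_bar1 G \<alpha>) (h_bar2 G \<beta>) (start (Knw G))"
  \<comment> \<open>Forgetting the knowledge that \<open>h_bar2\<close> attached gives back
    \<open>\<beta>\<close>, as the linking hypothesis demands.\<close>
  have N: "?N = distr ?M seq_algebra (h_play G)"
    using strategy1_h_bar1[OF \<alpha>] strategy2_h_bar2[OF \<beta>]
    by (rule play_measure_Knw)
      (simp_all add: h_bar1_def h_pref_inv_h_pref h_bar2_eq[OF \<beta>] pmf.map_comp o_def)
  obtain B where B: "B \<in> borel_sets (cantor_topology (observations G \<times> alphabet G))"
      "\<phi> = {\<pi>\<in>Plays G. play_obs G \<pi> \<in> B}"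
    using \<phi> by (auto simp: borel_obs_objective_def)
  let ?g = "\<lambda>(l, a). (state_obs G l, a)"
  have "\<phi> = Plays G \<inter> {\<pi>. (\<forall>i. ?g (\<pi> i) \<in> observations G \<times> alphabet G) \<and> (\<lambda>i. ?g (\<pi> i)) \<in> B}"
    using B(2) state_obs_in(1) by (auto simp: play_obs_def Plays_def case_prod_unfold)
  also have "\<dots> \<in> sets seq_algebra"
    using Plays_measurable[OF G.nonblocking_arena_axioms] borel_preimage_measurable[OF B(1)]
    by (rule sets.Int)
  finally have meas: "\<phi> \<in> sets seq_algebra" .
  have "proj_play \<in> (seq_algebra :: ('l set \<times> 'l, 'a) play measure) \<rightarrow>\<^sub>M seq_algebra"
    by (rule measurable_seqI) (simp add: proj_play_def cylinder_def)
  from measurable_sets[OF this meas]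
  have "proj_play -` \<phi> \<inter> Plays (Knw G) \<in> sets seq_algebra"
    using Plays_measurable[OF H.nonblocking_arena_axioms] by (auto simp: space_PiM)
  moreover have "proj_play -` \<phi> \<inter> Plays (Knw G) = h_play G ` \<phi>"
  proof (intro equalityI subsetI)
    fix \<sigma> assume "\<sigma> \<in> proj_play -` \<phi> \<inter> Plays (Knw G)"
    then show "\<sigma> \<in> h_play G ` \<phi>" by (metis IntE h_play_proj_play image_eqI vimageE)
  next
    fix \<sigma> assume "\<sigma> \<in> h_play G ` \<phi>"
    then show "\<sigma> \<in> proj_play -` \<phi> \<inter> Plays (Knw G)"
      using B(2) h_play_in_Plays by (auto simp: proj_play_h_play)
  qed
  ultimately have "h_play G ` \<phi> \<in> sets seq_algebra" by simp
  moreover have "h_play G \<in> ?M \<rightarrow>\<^sub>M seq_algebra"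
    using measurable_seqI[of "h_play G", OF h_play_cong]
    by (simp add: measurable_cong_sets[OF sets_play_measure refl])
  ultimately have "measure ?N (h_play G ` \<phi>) = measure ?M (h_play G -` h_play G ` \<phi>)"
    unfolding N by (simp add: measure_distr space_play_measure)
  moreover have "inj (h_play G)" by (rule inj_on_inverseI) (rule proj_play_h_play)
  ultimately show ?thesis by (simp add: inj_vimage_image_eq)
qed

lemma measure_h_vimage:
  assumes \<phi>: "borel_objective (Knw G) \<phi>"
    and \<alpha>: "strategy1 (Knw G) \<alpha>" and \<beta>: "strategy2 (Knw G) \<beta>"
  shows "measure (play_measure \<alpha> \<beta> (start (Knw G))) \<phi> =
    measure (play_measure (g_bar1 G \<alpha>) (g_bar2 G \<beta>) (start G)) {\<pi> \<in> Plays G. h_play G \<pi> \<in> \<phi>}"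
proof -
  let ?M = "play_measure (g_bar1 G \<alpha>) (g_bar2 G \<beta>) (start G)"
  have N: "play_measure \<alpha> \<beta> (start (Knw G)) = distr ?M seq_algebra (h_play G)"
    using \<alpha> \<beta> by (rule play_measure_Knw) (simp_all add: g_bar1_def g_bar2_eq[OF \<beta>])
  have \<phi>_Plays: "\<phi> \<subseteq> Plays (Knw G)"
    and \<phi>_borel: "\<phi> \<in> borel_sets (cantor_topology (states (Knw G) \<times> alphabet (Knw G)))"
    using \<phi> by (auto simp: borel_objective_def)
  have "{\<sigma>. (\<forall>i. \<sigma> i \<in> states (Knw G) \<times> alphabet (Knw G)) \<and> (\<lambda>i. \<sigma> i) \<in> \<phi>} = \<phi>"
    using \<phi>_Plays by (auto simp: Plays_def mem_Times_iff)
  with borel_preimage_measurable[OF \<phi>_borel, of "\<lambda>x. x"]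
  have "\<phi> \<in> sets seq_algebra" by simp
  moreover have "h_play G \<in> ?M \<rightarrow>\<^sub>M seq_algebra"
    using measurable_seqI[of "h_play G", OF h_play_cong]
    by (simp add: measurable_cong_sets[OF sets_play_measure refl])
  ultimately have "measure (play_measure \<alpha> \<beta> (start (Knw G))) \<phi> = measure ?M (h_play G -` \<phi>)"
    unfolding N by (simp add: measure_distr space_play_measure)
  \<comment> \<open>A sequence mapped into \<open>\<phi>\<close> is itself a play: its image is a
    play of Knw(G), and projecting recovers the sequence.\<close>
  moreover have "h_play G -` \<phi> = {\<pi> \<in> Plays G. h_play G \<pi> \<in> \<phi>}"
    using \<phi>_Plays proj_play_in_Plays[of "h_play G _"] by (auto simp: proj_play_h_play)
  ultimately show ?thesis by simp
qed

end

theorem theorem4p2: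
  fixes G :: "('l::finite, 'a::finite, 'o) obs_arena"
    and H :: "('l set \<times> 'l, 'a) arena"
  assumes "game_structure G"
    and "H = Knw G"
  shows "(\<forall>\<phi> \<alpha> \<beta>.
            borel_obs_objective G \<phi> \<longrightarrow>
            strategy1 G \<alpha> \<longrightarrow> observation_based G \<alpha> \<longrightarrow> strategy2 G \<beta> \<longrightarrow>
            measure (play_measure \<alpha> \<beta> (start G)) \<phi> =
            measure (play_measure (h_bar1 G \<alpha>) (h_bar2 G \<beta>) (start H)) (h_play G ` \<phi>)) \<and>
         (\<forall>\<phi> \<alpha> \<beta>.
            borel_objective H \<phi> \<longrightarrow> equiv_preserving_objective H \<phi> \<longrightarrow>
            strategy1 H \<alpha> \<longrightarrow> equiv_preserving_strategy H \<alpha> \<longrightarrow> strategy2 H \<beta> \<longrightarrow>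
            measure (play_measure \<alpha> \<beta> (start H)) \<phi> =
            measure (play_measure (g_bar1 G \<alpha>) (g_bar2 G \<beta>) (start G))
              {\<pi> \<in> Plays G. h_play G \<pi> \<in> \<phi>})"
proof (cases "alphabet G = {}")
  case True
  \<comment> \<open>Without letters there are no infinite plays, so every objective is empty and all
    probabilities in question are 0.\<close>
  then have "Plays G = {}" "Plays (Knw G) = {}"
    by (auto simp: Plays_def Knw_def Let_def)
  then show ?thesis
    using assms(2) by (auto simp: borel_obs_objective_def borel_objective_def)
next
  case False
  then interpret knowledge_game G
    using assms(1) by unfold_locales
  show ?thesis
    unfolding assms(2) using measure_h_image measure_h_vimage by blast
qed

end
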